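(* Let $d\in\mathbb{N}$, let $c>0$ and let $U$ be a unit random vector in $\mathbb{R}^d$. The multivariate Dickman random variable $D_c^U$ is the unique fixed point (in distribution, among random vectors in $\mathbb{R}^d$) of the distributional transformation $W\mapsto W^*$ given by $$W^*=_d Q^{1/c}(W+U),$$ where $Q$ is uniformly distributed on $[0,1]$ and $Q$, $U$ and $W$ are mutually independent.
   Context: $=_d$ denotes equality in distribution. A unit random vector takes values in the unit sphere of $\mathbb{R}^d$ (Euclidean norm). $\eta_c$ is the Poisson process on $(0,\infty)$ with intensity measure $ct^{-1}\,dt$, and $\eta_c^U=\sum_{k=1}^\infty\delta_{U_kZ_k}$ is the point process on $\mathbb{R}^d\setminus\{0\}$ where $(Z_k)_{k\in\mathbb{N}}$ enumerates the points of $\eta_c$ and $(U_k)_{k\in\mathbb{N}}$ are i.i.d. copies of $U$ independent of $\eta_c$. The multivariate Dickman random variable with parameters $(c,U)$ is $D_c^U=\int_{B_1}x\,\eta_c^U(dx)=\sum_{x\in\eta_c^U\cap B_1}x$, where $B_1$ is the closed unit ball centred at the origin. *)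

theory Defs
  imports "HOL-Probability.Probability"
begin

definition indep_rv ::
  "'w measure \<Rightarrow> 'a measure \<Rightarrow> ('w \<Rightarrow> 'a) \<Rightarrow> 'b measure \<Rightarrow> ('w \<Rightarrow> 'b) \<Rightarrow> bool"
  \<comment> \<open>The library's \<open>indep_var\<close> requires both variables to have the same range type.\<close>
  where
  "indep_rv M A X B Y \<longleftrightarrow>
     X \<in> M \<rightarrow>\<^sub>M A \<and> Y \<in> M \<rightarrow>\<^sub>M B \<and>
     prob_space.indep_set M {X -` S \<inter> space M | S. S \<in> sets A} {Y -` S \<inter> space M | S. S \<in> sets B}"

definition poisson_process :: "'w measure \<Rightarrow> ('w \<Rightarrow> 'a measure) \<Rightarrow> 'a measure \<Rightarrow> bool" where
  "poisson_process M \<eta> \<Lambda> \<longleftrightarrow>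
     prob_space M \<and>
     (\<forall>\<omega>\<in>space M. sets (\<eta> \<omega>) = sets \<Lambda>) \<and>
     (\<forall>A\<in>sets \<Lambda>. (\<lambda>\<omega>. emeasure (\<eta> \<omega>) A) \<in> borel_measurable M) \<and>
     (\<forall>A\<in>sets \<Lambda>. emeasure \<Lambda> A < \<infinity> \<longrightarrow>
        (\<forall>n. measure M {\<omega> \<in> space M. emeasure (\<eta> \<omega>) A = of_nat n} =
             exp (- measure \<Lambda> A) * measure \<Lambda> A ^ n / fact n)) \<and>
     (\<forall>A\<in>sets \<Lambda>. emeasure \<Lambda> A = \<infinity> \<longrightarrow> (AE \<omega> in M. emeasure (\<eta> \<omega>) A = \<infinity>)) \<and>
     (\<forall>(n::nat) A. A ` {..<n} \<subseteq> sets \<Lambda> \<and> disjoint_family_on A {..<n} \<longrightarrow>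
        prob_space.indep_vars M (\<lambda>_. borel) (\<lambda>i \<omega>. emeasure (\<eta> \<omega>) (A i)) {..<n})"

definition point_measure :: "'a measure \<Rightarrow> (nat \<Rightarrow> 'a) \<Rightarrow> 'a measure"
  \<comment> \<open>The sum of the Dirac measures at \<open>x 0, x 1, \<dots>\<close>, with multiplicities,
      as the image of the counting measure on the naturals.\<close>
  where
  "point_measure S x = distr (count_space UNIV) S x"

definition dickman_intensity :: "real \<Rightarrow> real measure" where
  "dickman_intensity c = density (restrict_space lborel {0<..}) (\<lambda>t. ennreal (c / t))"

definition dickman_data ::
  "'w measure \<Rightarrow> real \<Rightarrow> 'a::euclidean_space measure \<Rightarrow> (nat \<Rightarrow> 'w \<Rightarrow> real) \<Rightarrow> (nat \<Rightarrow> 'w \<Rightarrow> 'a) \<Rightarrow> bool"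
  \<comment> \<open>\<open>Z\<close> enumerates a Poisson process with intensity \<open>c/t dt\<close> on the positive reals, and the
      \<open>V k\<close> are i.i.d. with law \<open>\<nu>\<close>. The marks are independent of the enumeration \<open>Z\<close>; when
      the \<open>Z k\<close> are functions of the process, as usual, this is independence of the process.\<close>
  where
  "dickman_data M c \<nu> Z V \<longleftrightarrow>
     prob_space M \<and>
     (\<forall>k. Z k \<in> borel_measurable M) \<and> (\<forall>k. \<forall>\<omega>\<in>space M. 0 < Z k \<omega>) \<and>
     poisson_process M (\<lambda>\<omega>. point_measure (restrict_space borel {0<..}) (\<lambda>k. Z k \<omega>)) (dickman_intensity c) \<and>
     prob_space.indep_vars M (\<lambda>_. borel) V UNIV \<and>
     (\<forall>k. distr M borel (V k) = \<nu>) \<and>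
     indep_rv M (PiM UNIV (\<lambda>_. borel)) (\<lambda>\<omega> k. V k \<omega>) (PiM UNIV (\<lambda>_. borel)) (\<lambda>\<omega> k. Z k \<omega>)"

definition marked_process ::
  "(nat \<Rightarrow> 'w \<Rightarrow> real) \<Rightarrow> (nat \<Rightarrow> 'w \<Rightarrow> 'a::euclidean_space) \<Rightarrow> 'w \<Rightarrow> 'a measure" where
  "marked_process Z V \<omega> = point_measure borel (\<lambda>k. Z k \<omega> *\<^sub>R V k \<omega>)"

definition dickman_vector ::
  "(nat \<Rightarrow> 'w \<Rightarrow> real) \<Rightarrow> (nat \<Rightarrow> 'w \<Rightarrow> 'a::euclidean_space) \<Rightarrow> 'w \<Rightarrow> 'a"
  \<comment> \<open>The integrand is almost surely integrable; the Bochner integral is 0 on the exceptional null set.\<close>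
  where
  "dickman_vector Z V \<omega> = (LINT x:cball 0 1|marked_process Z V \<omega>. x)"

definition dickman_transform ::
  "real \<Rightarrow> 'a::euclidean_space measure \<Rightarrow> 'a measure \<Rightarrow> 'a measure"
  \<comment> \<open>The map sending the law \<open>\<mu>\<close> of \<open>W\<close> to the law of \<open>W*\<close>, where \<open>\<nu>\<close> is the law of \<open>U\<close>:
      under the product measure the coordinates are mutually independent.\<close>
  where
  "dickman_transform c \<nu> \<mu> =
     distr (uniform_measure lborel {0..1} \<Otimes>\<^sub>M \<nu> \<Otimes>\<^sub>M \<mu>) borel
       (\<lambda>(q, u, w). (q powr (1 / c)) *\<^sub>R (w + u))"

lemma distr_Pair_indep_rv:
  assumes "prob_space M" and ind: "indep_rv M A X B Y"
  shows "distr M (A \<Otimes>\<^sub>M B) (\<lambda>\<omega>. (X \<omega>, Y \<omega>)) = distr M A X \<Otimes>\<^sub>M distr M B Y"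
proof -
  interpret prob_space M by fact
  have X [measurable]: "X \<in> M \<rightarrow>\<^sub>M A" and Y [measurable]: "Y \<in> M \<rightarrow>\<^sub>M B"
    and i: "indep_set {X -` S \<inter> space M | S. S \<in> sets A} {Y -` S \<inter> space M | S. S \<in> sets B}"
    using ind by (auto simp: indep_rv_def)
  interpret PX: prob_space "distr M A X" by (rule prob_space_distr) fact
  interpret PY: prob_space "distr M B Y" by (rule prob_space_distr) fact
  have "distr M A X \<Otimes>\<^sub>M distr M B Y = distr M (A \<Otimes>\<^sub>M B) (\<lambda>\<omega>. (X \<omega>, Y \<omega>))"
  proof (rule pair_measure_eqI)
    fix S T assume "S \<in> sets (distr M A X)" "T \<in> sets (distr M B Y)"
    then have S [measurable]: "S \<in> sets A" and T [measurable]: "T \<in> sets B" by auto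
    have "prob ((X -` S \<inter> space M) \<inter> (Y -` T \<inter> space M)) =
        prob (X -` S \<inter> space M) * prob (Y -` T \<inter> space M)"
      by (rule indep_setD[OF i]) (use S T in auto)
    moreover have "(\<lambda>\<omega>. (X \<omega>, Y \<omega>)) -` (S \<times> T) \<inter> space M = (X -` S \<inter> space M) \<inter> (Y -` T \<inter> space M)"
      by auto
    ultimately show "emeasure (distr M A X) S * emeasure (distr M B Y) T =
        emeasure (distr M (A \<Otimes>\<^sub>M B) (\<lambda>\<omega>. (X \<omega>, Y \<omega>))) (S \<times> T)"
      by (simp add: emeasure_distr emeasure_eq_measure ennreal_mult)
  qed (auto simp: PX.sigma_finite_measure PY.sigma_finite_measure cong: sets_pair_measure_cong
        intro: PX.sigma_finite_measure_axioms PY.sigma_finite_measure_axioms)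
  then show ?thesis by simp
qed

lemma dickman_transform_eq_distr:
  fixes U W :: "'w \<Rightarrow> 'a::euclidean_space"
  assumes "prob_space M"
    and "distr M borel Q = uniform_measure lborel {0..1}"
    and "indep_rv M borel U borel W"
    and "indep_rv M borel Q (borel \<Otimes>\<^sub>M borel) (\<lambda>\<omega>. (U \<omega>, W \<omega>))"
  shows "distr M borel (\<lambda>\<omega>. (Q \<omega> powr (1 / c)) *\<^sub>R (W \<omega> + U \<omega>)) =
    dickman_transform c (distr M borel U) (distr M borel W)"
proof -
  have [measurable]: "U \<in> borel_measurable M" "W \<in> borel_measurable M" "Q \<in> borel_measurable M"
    using assms by (auto simp: indep_rv_def)
  have "dickman_transform c (distr M borel U) (distr M borel W) =
    distr (distr M (borel \<Otimes>\<^sub>M borel \<Otimes>\<^sub>M borel) (\<lambda>\<omega>. (Q \<omega>, U \<omega>, W \<omega>))) borel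
       (\<lambda>(q, u, w). (q powr (1 / c)) *\<^sub>R (w + u))"
    unfolding dickman_transform_def
    by (simp add: assms(2)[symmetric] distr_Pair_indep_rv[OF assms(1,3)] distr_Pair_indep_rv[OF assms(1,4)])
  also have "\<dots> = distr M borel (\<lambda>\<omega>. (Q \<omega> powr (1 / c)) *\<^sub>R (W \<omega> + U \<omega>))"
    by (subst distr_distr) (auto simp: comp_def)
  finally show ?thesis by simp
qed

end

theory Submission imports Defs begin

text \<open>
  \<^bold>\<open>Uniqueness.\<close> Written on test functions, the transform maps \<open>g\<close> to
  \<open>w \<mapsto> E (g (Q powr (1/c) * (w + U)))\<close>. This multiplies Lipschitz constants by \<open>c / (c + 1)\<close>. Iterated on a
  bounded Lipschitz function it produces functions that flatten out to a constant, which has to be the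
  integral of \<open>g\<close> against any fixed point (\<open>fixed_point_integral_limit\<close>). As bounded Lipschitz functions
  determine a law (\<open>measure_eq_bounded_lipschitz\<close>), there is at most one fixed point.

  \<^bold>\<open>Existence.\<close> The intensity \<open>c / t\<close> is scale invariant, so the Poisson points below \<open>q < 1\<close> look like
  \<open>q\<close> times all the points below 1 and are independent of those in \<open>(q, 1]\<close>. Hence \<open>D\<close> has the law of
  \<open>q D' + X\<close>, where \<open>D'\<close> is a copy of \<open>D\<close> and \<open>X\<close> collects the points in \<open>(q, 1]\<close>. Let \<open>l = c * ln (1 / q)\<close> be
  the mean number of these points. If \<open>l\<close> is small, \<open>X\<close> vanishes with probability \<open>exp (- l)\<close>, is close
  to a copy of \<open>U\<close> with probability \<open>l * exp (- l)\<close>, and anything else has probability of order \<open>l\<^sup>2\<close>.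
  Apply this to the test function \<open>f w = E (g (Q powr (1/c) * w))\<close>. It satisfies
  \<open>f w - exp (- l) * f (q w) = (1 - exp (- l)) * g w\<close> up to order \<open>l\<^sup>2\<close>, because the probability that \<open>X\<close>
  vanishes is just \<open>q powr c\<close> (\<open>shrink_mean_split\<close>). Division by \<open>l\<close> and \<open>l \<rightarrow> 0\<close> give
  \<open>E (g D) = E (f (D + U))\<close>, which is the fixed point equation tested on \<open>g\<close>.

  To make this rigorous for an arbitrary enumeration of the points, with nothing known but
  Poisson counts, the points are rounded up to the grid of the powers of \<open>q\<close>. Given the points, the law
  of the rounded sum depends only on the numbers of points in the cells \<open>(q ^ Suc j, q ^ j]\<close>
  (\<open>expectation_eq_layered\<close>), and these numbers are independent with one and the same Poisson law. The
  self-similarity of the rounded sum is then a shift of the index \<open>j\<close>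
  (\<open>expectation_layered_first_order\<close>). The rounding error is at most \<open>l\<close> in expectation
  (\<open>dominated_trunc_diff\<close>), and it occurs only with factors of order \<open>l\<close>, which makes it negligible
  (\<open>near_invariance\<close>).
\<close>

section \<open>Bounded Lipschitz test functions\<close>

definition bounded_lipschitz :: "real \<Rightarrow> real \<Rightarrow> ('a::real_normed_vector \<Rightarrow> real) \<Rightarrow> bool" where
  "bounded_lipschitz B L g \<longleftrightarrow> (\<forall>x. \<bar>g x\<bar> \<le> B) \<and> L-lipschitz_on UNIV g"

lemma bounded_lipschitzI:
  assumes "\<And>x. \<bar>g x\<bar> \<le> B" "\<And>x y. \<bar>g x - g y\<bar> \<le> L * norm (x - y)" "0 \<le> L"
  shows "bounded_lipschitz B L g"
  using assms by (auto simp: bounded_lipschitz_def lipschitz_on_def dist_norm)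

lemma bounded_lipschitzD:
  assumes "bounded_lipschitz B L g"
  shows "\<bar>g x\<bar> \<le> B" "\<bar>g x - g y\<bar> \<le> L * norm (x - y)" "0 \<le> L" "0 \<le> B"
proof -
  have "L-lipschitz_on UNIV g" using assms by (simp add: bounded_lipschitz_def)
  then show "\<bar>g x - g y\<bar> \<le> L * norm (x - y)" "0 \<le> L"
    by (auto dest: lipschitz_onD lipschitz_on_nonneg simp: dist_norm)
  show *: "\<bar>g x\<bar> \<le> B" for x using assms by (simp add: bounded_lipschitz_def)
  show "0 \<le> B" using *[of 0] by linarith
qed

lemma bounded_lipschitz_measurable:
  fixes g :: "'a::euclidean_space \<Rightarrow> real"
  assumes "bounded_lipschitz B L g"
  shows "g \<in> borel_measurable borel"
  using assms unfolding bounded_lipschitz_def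
  by (intro borel_measurable_continuous_onI lipschitz_on_continuous_on[of L]) auto

lemma bounded_lipschitz_scale:
  fixes g :: "'a::real_normed_vector \<Rightarrow> real"
  assumes "bounded_lipschitz B L g"
  shows "bounded_lipschitz B (L * \<bar>r\<bar>) (\<lambda>w. g (r *\<^sub>R w))"
proof (rule bounded_lipschitzI)
  show "\<bar>g (r *\<^sub>R x) - g (r *\<^sub>R y)\<bar> \<le> L * \<bar>r\<bar> * norm (x - y)" for x y
    using bounded_lipschitzD(2)[OF assms, of "r *\<^sub>R x" "r *\<^sub>R y"]
    by (simp add: scaleR_diff_right[symmetric] mult.assoc)
qed (use bounded_lipschitzD[OF assms] in auto)

lemma bounded_lipschitz_mono:
  assumes "bounded_lipschitz B L g" "L \<le> L'"
  shows "bounded_lipschitz B L' g"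
  using assms by (auto simp: bounded_lipschitz_def intro: lipschitz_on_le)

lemma (in prob_space) integrable_bounded_lipschitz:
  fixes g :: "'b::euclidean_space \<Rightarrow> real"
  assumes "bounded_lipschitz B L g" "X \<in> borel_measurable M"
  shows "integrable M (\<lambda>\<omega>. g (X \<omega>))"
proof (rule integrable_const_bound[of _ B])
  show "(\<lambda>\<omega>. g (X \<omega>)) \<in> borel_measurable M"
    using bounded_lipschitz_measurable[OF assms(1)] assms(2) by measurable
qed (use bounded_lipschitzD(1)[OF assms(1)] in auto)

lemma (in prob_space) abs_expectation_le:
  fixes f :: "'a \<Rightarrow> real"
  assumes "AE x in M. \<bar>f x\<bar> \<le> B" "0 \<le> B"
  shows "\<bar>expectation f\<bar> \<le> B"
proof (cases "integrable M f")
  case True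
  have "\<bar>expectation f\<bar> \<le> expectation (\<lambda>x. \<bar>f x\<bar>)" by (rule integral_abs_bound)
  also have "\<dots> \<le> expectation (\<lambda>x. B)"
    using True assms by (intro integral_mono_AE) auto
  finally show ?thesis by (simp add: prob_space)
qed (use assms in \<open>simp add: not_integrable_integral_eq\<close>)

lemma (in prob_space) bounded_lipschitz_expectation:
  fixes h :: "'a \<Rightarrow> 'b::real_normed_vector \<Rightarrow> real"
  assumes g: "\<And>x. x \<in> space M \<Longrightarrow> bounded_lipschitz B L (h x)"
    and m: "\<And>w. (\<lambda>x. h x w) \<in> borel_measurable M"
  shows "bounded_lipschitz B L (\<lambda>w. expectation (\<lambda>x. h x w))"
proof -
  obtain x0 where x0: "x0 \<in> space M" using not_empty by blast
  have int: "integrable M (\<lambda>x. h x w)" for w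
    by (rule integrable_const_bound[of _ B]) (use m bounded_lipschitzD(1)[OF g] in auto)
  show ?thesis
  proof (rule bounded_lipschitzI)
    show "\<bar>expectation (\<lambda>x. h x w)\<bar> \<le> B" for w
      by (rule abs_expectation_le) (use bounded_lipschitzD[OF g] x0 in auto)
    show "\<bar>expectation (\<lambda>x. h x w) - expectation (\<lambda>x. h x v)\<bar> \<le> L * norm (w - v)" for w v
      unfolding Bochner_Integration.integral_diff[OF int int, symmetric]
      by (rule abs_expectation_le) (use bounded_lipschitzD[OF g] x0 in auto)
    show "0 \<le> L" by (rule bounded_lipschitzD(3)[OF g[OF x0]])
  qed
qed

text \<open>The indicator of a closed set \<open>C\<close> is the pointwise limit of the Lipschitz functions
  \<open>max 0 (1 - n * infdist x C)\<close>, and the closed sets are a \<open>\<inter>\<close>-stable generator of the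
  Borel sets.\<close>

lemma measure_eq_bounded_lipschitz:
  fixes \<mu> \<mu>' :: "'a::euclidean_space measure"
  assumes "prob_space \<mu>" "prob_space \<mu>'" and S: "sets \<mu> = sets borel" "sets \<mu>' = sets borel"
    and eq: "\<And>B L g. bounded_lipschitz B L g \<Longrightarrow> (\<integral>x. g x \<partial>\<mu>) = (\<integral>x. g x \<partial>\<mu>')"
  shows "\<mu> = \<mu>'"
proof -
  interpret m: prob_space \<mu> by fact
  interpret m': prob_space \<mu>' by fact
  have meas: "measure \<mu> C = measure \<mu>' C" if C: "closed C" for C :: "'a set"
  \<comment> \<open>The empty set is separate because \<open>infdist x {}\<close> is 0, which would make every \<open>g n\<close> constantly 1.\<close>
  proof (cases "C = {}")
    case False
    define g where "g n x = max 0 (1 - real n * infdist x C)" for n x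
    have bl: "bounded_lipschitz 1 (real n) (g n)" for n
    proof (rule bounded_lipschitzI)
      show "\<bar>g n x\<bar> \<le> 1" for x using infdist_nonneg[of x C] by (auto simp: g_def)
      show "\<bar>g n x - g n y\<bar> \<le> real n * norm (x - y)" for x y
      proof -
        have "\<bar>infdist x C - infdist y C\<bar> \<le> norm (x - y)"
          using infdist_triangle_abs[of x C y] by (simp add: dist_norm)
        then have "real n * \<bar>infdist x C - infdist y C\<bar> \<le> real n * norm (x - y)"
          by (intro mult_left_mono) auto
        moreover have "\<bar>g n x - g n y\<bar> \<le> \<bar>real n * infdist x C - real n * infdist y C\<bar>"
          by (auto simp: g_def)
        ultimately show ?thesis by (simp add: right_diff_distrib[symmetric] abs_mult)
      qed
    qed simp
    have lim: "(\<lambda>n. g n x) \<longlonglongrightarrow> indicator C x" for x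
    proof (cases "x \<in> C")
      case True then show ?thesis using False by (simp add: g_def)
    next
      case xC: False
      then have pos: "0 < infdist x C" using C False infdist_pos_not_in_closed by metis
      obtain N :: nat where N: "1 / infdist x C < real N" using reals_Archimedean2 by blast
      have "g n x = 0" if "n \<ge> N" for n
      proof -
        have "1 / infdist x C < real n" using N that by (meson less_le_trans of_nat_le_iff)
        then show ?thesis using pos by (simp add: g_def field_simps max_def)
      qed
      then show ?thesis using xC
        by (intro tendsto_eventually) (auto simp: eventually_sequentially)
    qed
    have L: "(\<lambda>n. \<integral>x. g n x \<partial>N) \<longlonglongrightarrow> measure N C" if N: "prob_space N" "sets N = sets borel" for N
    proof -
      interpret N: prob_space N by fact
      have "(\<lambda>n. \<integral>x. g n x \<partial>N) \<longlonglongrightarrow> (\<integral>x. indicator C x \<partial>N)"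
      proof (rule integral_dominated_convergence[where w="\<lambda>_. 1"])
        show "g n \<in> borel_measurable N" for n
          using bounded_lipschitz_measurable[OF bl, of n] N(2) by (simp cong: measurable_cong_sets)
        show "(indicator C :: _ \<Rightarrow> real) \<in> borel_measurable N"
          by (rule borel_measurable_indicator) (use C N(2) in \<open>simp add: borel_closed\<close>)
      qed (use lim bounded_lipschitzD(1)[OF bl] in auto)
      then show ?thesis using C N by (simp add: borel_closed sets_eq_imp_space_eq)
    qed
    have "(\<lambda>n. \<integral>x. g n x \<partial>\<mu>) \<longlonglongrightarrow> measure \<mu>' C"
      using L[OF assms(2) S(2)] eq[OF bl] by simp
    with L[OF assms(1) S(1)] show ?thesis by (rule LIMSEQ_unique)
  qed simp
  show ?thesis
  proof (rule measure_eqI_generator_eq[where E="Collect closed" and \<Omega>=UNIV and A="\<lambda>_. UNIV"])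
    show "Int_stable (Collect closed :: 'a set set)" by (auto simp: Int_stable_def)
    show "sets \<mu> = sigma_sets UNIV (Collect closed)" "sets \<mu>' = sigma_sets UNIV (Collect closed)"
      using S by (simp_all add: borel_eq_closed)
  qed (auto simp: meas m.emeasure_eq_measure m'.emeasure_eq_measure)
qed

section \<open>The transform on test functions\<close>

text \<open>Dually to its action on laws, the transform sends a test function \<open>g\<close> to
  \<open>w \<mapsto> E (g (Q powr (1/c) * (w + U)))\<close>. The two averages in it are kept apart: the inner one, over \<open>Q\<close>,
  contracts Lipschitz constants and satisfies a renewal-type identity in the scale, whereas the outer
  one, over \<open>U\<close>, also describes the effect of a single Poisson point.\<close>

definition shift_mean :: "'a::euclidean_space measure \<Rightarrow> ('a \<Rightarrow> real) \<Rightarrow> 'a \<Rightarrow> real" where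
  "shift_mean \<nu> g w = (\<integral>u. g (w + u) \<partial>\<nu>)"

definition shrink_mean :: "real \<Rightarrow> ('a::euclidean_space \<Rightarrow> real) \<Rightarrow> 'a \<Rightarrow> real" where
  "shrink_mean c g w = (\<integral>t. g (t powr (1 / c) *\<^sub>R w) \<partial>uniform_measure lborel {0..1})"

lemma bounded_lipschitz_shift_mean:
  assumes "prob_space \<nu>" "sets \<nu> = sets borel" "bounded_lipschitz B L g"
  shows "bounded_lipschitz B L (shift_mean \<nu> g)"
  unfolding shift_mean_def
proof (rule prob_space.bounded_lipschitz_expectation[OF assms(1)])
  show "bounded_lipschitz B L (\<lambda>w. g (w + x))" for x
    using bounded_lipschitzD[OF assms(3)]
    by (intro bounded_lipschitzI) (auto, metis add_diff_cancel_right)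
  have [measurable]: "g \<in> borel_measurable borel" by (rule bounded_lipschitz_measurable[OF assms(3)])
  show "(\<lambda>x. g (w + x)) \<in> borel_measurable \<nu>" for w
    using assms(2) by (simp cong: measurable_cong_sets)
qed

lemma prob_space_uniform_01: "prob_space (uniform_measure lborel {0..1::real})"
  by (rule prob_space_uniform_measure) auto

lemma AE_uniform_01: "AE t in uniform_measure lborel {0..1::real}. 0 \<le> t \<and> t \<le> 1"
  by (rule AE_uniform_measureI) auto

lemma uniform_01_integral:
  fixes h :: "real \<Rightarrow> real"
  assumes [measurable]: "h \<in> borel_measurable borel"
  shows "(\<integral>t. h t \<partial>uniform_measure lborel {0..1}) = (LBINT t:{0..1}. h t)"
proof -
  have "uniform_measure lborel {0..1::real} = density lborel (\<lambda>t. ennreal (indicator {0..1} t))"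
    unfolding uniform_measure_def by (intro density_cong) (auto simp: indicator_def divide_ennreal_def)
  then show ?thesis
    by (simp add: integral_density set_lebesgue_integral_def)
qed

text \<open>The contraction factor \<open>c / (c + 1)\<close> is the mean of \<open>Q powr (1/c)\<close>.\<close>

lemma bounded_lipschitz_shrink_mean:
  fixes g :: "'a::euclidean_space \<Rightarrow> real"
  assumes g: "bounded_lipschitz B L g" and c: "0 < c"
  shows "bounded_lipschitz B (L * (c / (c + 1))) (shrink_mean c g)"
proof (rule bounded_lipschitzI)
  let ?U = "uniform_measure lborel {0..1::real}"
  interpret U: prob_space ?U by (rule prob_space_uniform_01)
  have [measurable]: "g \<in> borel_measurable borel" by (rule bounded_lipschitz_measurable[OF g])
  note D = bounded_lipschitzD[OF g]
  have int: "integrable ?U (\<lambda>t. g (t powr (1 / c) *\<^sub>R w))" for w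
    by (rule U.integrable_bounded_lipschitz[OF g]) simp
  have intp: "integrable ?U (\<lambda>t. t powr (1 / c))"
  proof (rule U.integrable_const_bound[of _ 1])
    show "AE t in ?U. norm (t powr (1 / c)) \<le> 1"
      using AE_uniform_01 by eventually_elim (use c in \<open>auto intro: powr_le1\<close>)
  qed simp
  have mean: "(\<integral>t. t powr (1 / c) \<partial>?U) = c / (c + 1)"
  proof -
    have le1: "indicator {0..1} t * t powr (1 / c) \<le> indicator {0..1} t" for t :: real
      using c by (cases "t \<in> {0..1}") (simp_all add: powr_le1)
    have *: "set_integrable lborel {0..1} (\<lambda>t::real. t powr (1 / c))"
      unfolding set_integrable_def real_scaleR_def
    proof (rule Bochner_Integration.integrable_bound)
      show "integrable lborel (indicator {0..1::real} :: _ \<Rightarrow> real)" by simp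
      show "AE t in lborel. norm (indicator {0..1} t * t powr (1 / c)) \<le> norm (indicator {0..1::real} t :: real)"
        using le1 by (intro AE_I2) simp
    qed measurable
    have "((\<lambda>t::real. t powr (1 / c)) has_integral (LBINT t:{0..1}. t powr (1 / c))) {0..1}"
      using integrable_integral[OF set_borel_integral_eq_integral(1)[OF *]]
      unfolding set_borel_integral_eq_integral(2)[OF *] .
    moreover have "((\<lambda>t::real. t powr (1 / c)) has_integral (1 powr (1 / c + 1) / (1 / c + 1))) {0..1}"
      by (rule has_integral_powr_from_0) (use c in \<open>simp_all add: less_trans[of _ 0]\<close>)
    ultimately have "(LBINT t:{0..1}. t powr (1 / c)) = 1 / (1 / c + 1)"
      by (auto dest: has_integral_unique)
    then show ?thesis using c by (simp add: uniform_01_integral field_simps)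
  qed
  show "\<bar>shrink_mean c g w\<bar> \<le> B" for w
    unfolding shrink_mean_def by (rule U.abs_expectation_le) (use D(1,4) in auto)
  show "\<bar>shrink_mean c g w - shrink_mean c g v\<bar> \<le> L * (c / (c + 1)) * norm (w - v)" for w v
  proof -
    have "\<bar>shrink_mean c g w - shrink_mean c g v\<bar>
        \<le> (\<integral>t. \<bar>g (t powr (1 / c) *\<^sub>R w) - g (t powr (1 / c) *\<^sub>R v)\<bar> \<partial>?U)"
      unfolding shrink_mean_def Bochner_Integration.integral_diff[OF int int, symmetric]
      by (rule integral_abs_bound)
    also have "\<dots> \<le> (\<integral>t. L * norm (w - v) * t powr (1 / c) \<partial>?U)"
    proof (rule integral_mono)
      show "integrable ?U (\<lambda>t. \<bar>g (t powr (1 / c) *\<^sub>R w) - g (t powr (1 / c) *\<^sub>R v)\<bar>)"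
        using int by auto
      show "\<bar>g (t powr (1 / c) *\<^sub>R w) - g (t powr (1 / c) *\<^sub>R v)\<bar> \<le> L * norm (w - v) * t powr (1 / c)" for t
        using D(2)[of "t powr (1 / c) *\<^sub>R w" "t powr (1 / c) *\<^sub>R v"]
        by (simp add: scaleR_diff_right[symmetric] mult_ac)
    qed (use intp in auto)
    also have "\<dots> = L * (c / (c + 1)) * norm (w - v)" by (simp add: mean)
    finally show ?thesis .
  qed
  show "0 \<le> L * (c / (c + 1))" using D(3) c by simp
qed

lemma prob_space_dickman_transform:
  assumes "prob_space \<nu>" "prob_space \<mu>" "sets \<nu> = sets borel" "sets \<mu> = sets borel"
  shows "prob_space (dickman_transform c \<nu> \<mu>)"
proof -
  interpret U: prob_space "uniform_measure lborel {0..1::real}" by (rule prob_space_uniform_01)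
  interpret n: prob_space \<nu> by fact
  interpret m: prob_space \<mu> by fact
  interpret nm: pair_prob_space \<nu> \<mu> ..
  interpret Unm: pair_prob_space "uniform_measure lborel {0..1::real}" "\<nu> \<Otimes>\<^sub>M \<mu>" ..
  show ?thesis
    unfolding dickman_transform_def
    by (rule Unm.prob_space_distr)
       (use assms(3,4) in \<open>simp cong: measurable_cong_sets sets_pair_measure_cong\<close>)
qed

lemma integral_dickman_transform:
  fixes g :: "'a::euclidean_space \<Rightarrow> real"
  assumes "prob_space \<nu>" "prob_space \<mu>" and S: "sets \<nu> = sets borel" "sets \<mu> = sets borel"
    and g: "bounded_lipschitz B L g" and c: "0 < c"
  shows "(\<integral>x. g x \<partial>dickman_transform c \<nu> \<mu>) = (\<integral>w. shift_mean \<nu> (shrink_mean c g) w \<partial>\<mu>)"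
proof -
  let ?U = "uniform_measure lborel {0..1::real}"
  interpret U: prob_space ?U by (rule prob_space_uniform_01)
  interpret n: prob_space \<nu> by fact
  interpret m: prob_space \<mu> by fact
  interpret nm: pair_prob_space \<nu> \<mu> ..
  interpret Unm: pair_prob_space ?U "\<nu> \<Otimes>\<^sub>M \<mu>" ..
  have [measurable]: "g \<in> borel_measurable borel" by (rule bounded_lipschitz_measurable[OF g])
  note f = bounded_lipschitz_shrink_mean[OF g c]
  note [measurable_cong] = S
  have [measurable]: "shrink_mean c g \<in> borel_measurable borel" by (rule bounded_lipschitz_measurable[OF f])
  have "(\<integral>x. g x \<partial>dickman_transform c \<nu> \<mu>)
      = (\<integral>x. g ((\<lambda>(q, u, w). (q powr (1 / c)) *\<^sub>R (w + u)) x) \<partial>(?U \<Otimes>\<^sub>M \<nu> \<Otimes>\<^sub>M \<mu>))"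
    unfolding dickman_transform_def by (subst integral_distr) auto
  also have "\<dots> = (\<integral>(q,y). g (q powr (1 / c) *\<^sub>R (snd y + fst y)) \<partial>(?U \<Otimes>\<^sub>M \<nu> \<Otimes>\<^sub>M \<mu>))"
    by (simp add: case_prod_unfold)
  also have "\<dots> = (\<integral>y. (\<integral>q. g (q powr (1 / c) *\<^sub>R (snd y + fst y)) \<partial>?U) \<partial>(\<nu> \<Otimes>\<^sub>M \<mu>))"
    by (rule Unm.integral_snd[symmetric], rule Unm.P.integrable_const_bound[of _ B])
       (use bounded_lipschitzD(1)[OF g] in auto)
  also have "\<dots> = (\<integral>(u,w). shrink_mean c g (w + u) \<partial>(\<nu> \<Otimes>\<^sub>M \<mu>))"
    by (intro Bochner_Integration.integral_cong refl) (auto simp: shrink_mean_def)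
  also have "\<dots> = (\<integral>w. (\<integral>u. shrink_mean c g (w + u) \<partial>\<nu>) \<partial>\<mu>)"
    by (rule nm.integral_snd[symmetric], rule nm.P.integrable_const_bound[of _ B])
       (use bounded_lipschitzD(1)[OF f] in auto)
  finally show ?thesis by (simp add: shift_mean_def)
qed

section \<open>At most one fixed point\<close>

text \<open>The integral of \<open>g\<close> against a fixed point does not change when \<open>g\<close> is replaced by its \<open>n\<close>-th
  image under the dual transform. The Lipschitz constants of these images tend to 0, so that they
  flatten out to constants, and the limiting constant has to be the integral. The left-hand side
  does not mention \<open>\<mu>\<close>; this is where uniqueness comes from. The
  passage to the limit under the integral is dominated by the constant \<open>2 * B\<close>, so that it applies to
  fixed points with arbitrarily heavy tails.\<close>

lemma fixed_point_integral_limit: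
  fixes \<nu> \<mu> :: "'a::euclidean_space measure"
  assumes P: "prob_space \<nu>" "prob_space \<mu>" and S: "sets \<nu> = sets borel" "sets \<mu> = sets borel"
    and c: "0 < c" and fp: "dickman_transform c \<nu> \<mu> = \<mu>" and g: "bounded_lipschitz B L g"
  shows "(\<lambda>n. ((\<lambda>h. shift_mean \<nu> (shrink_mean c h)) ^^ n) g 0) \<longlonglongrightarrow> (\<integral>x. g x \<partial>\<mu>)"
proof -
  define \<kappa> where "\<kappa> = c / (c + 1)"
  have \<kappa>: "0 \<le> \<kappa>" "\<kappa> < 1" using c by (auto simp: \<kappa>_def)
  define T where "T n = ((\<lambda>h. shift_mean \<nu> (shrink_mean c h)) ^^ n) g" for n
  interpret m: prob_space \<mu> by fact
  have T: "bounded_lipschitz B (L * \<kappa> ^ n) (T n)" for n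
  proof (induction n)
    case 0 then show ?case using g by (simp add: T_def)
  next
    case (Suc n)
    then have "bounded_lipschitz B (L * \<kappa> ^ n * \<kappa>) (T (Suc n))"
      using bounded_lipschitz_shift_mean[OF P(1) S(1) bounded_lipschitz_shrink_mean[OF Suc c]]
      by (simp add: T_def \<kappa>_def)
    then show ?case by (simp add: mult_ac)
  qed
  have int: "(\<integral>x. T n x \<partial>\<mu>) = (\<integral>x. g x \<partial>\<mu>)" for n
  proof (induction n)
    case (Suc n)
    then show ?case
      using integral_dickman_transform[OF P S T c, of n] by (simp add: fp T_def)
  qed (simp add: T_def)
  have meas[measurable]: "T n \<in> borel_measurable \<mu>" for n
    using bounded_lipschitz_measurable[OF T, of n] S(2) by (simp cong: measurable_cong_sets)
  have lim: "(\<lambda>n. T n x - T n 0) \<longlonglongrightarrow> 0" for x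
  proof (rule Lim_null_comparison)
    show "\<forall>\<^sub>F n in sequentially. norm (T n x - T n 0) \<le> L * \<kappa> ^ n * norm x"
      using bounded_lipschitzD(2)[OF T, of _ x 0] by simp
    have "(\<lambda>n. L * \<kappa> ^ n * norm x) \<longlonglongrightarrow> L * 0 * norm x"
      using \<kappa> by (intro tendsto_intros) auto
    then show "(\<lambda>n. L * \<kappa> ^ n * norm x) \<longlonglongrightarrow> 0" by simp
  qed
  have "(\<lambda>n. \<integral>x. T n x - T n 0 \<partial>\<mu>) \<longlonglongrightarrow> (\<integral>x. 0 \<partial>\<mu>)"
  proof (rule integral_dominated_convergence[where w="\<lambda>_. 2 * B"])
    show "AE x in \<mu>. norm (T n x - T n 0) \<le> 2 * B" for n
    proof (rule AE_I2)
      fix x show "norm (T n x - T n 0) \<le> 2 * B"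
        using bounded_lipschitzD(1)[OF T, of n x] bounded_lipschitzD(1)[OF T, of n 0] by simp
    qed
  qed (use lim in auto)
  moreover have "(\<integral>x. T n x - T n 0 \<partial>\<mu>) = (\<integral>x. g x \<partial>\<mu>) - T n 0" for n
  proof -
    have "integrable \<mu> (T n)"
      using m.integrable_const_bound[of "T n" B] bounded_lipschitzD(1)[OF T] by auto
    then show ?thesis by (simp add: int m.prob_space)
  qed
  ultimately have "(\<lambda>n. (\<integral>x. g x \<partial>\<mu>) - T n 0) \<longlonglongrightarrow> 0" by simp
  from tendsto_diff[OF tendsto_const[of "\<integral>x. g x \<partial>\<mu>"] this] show ?thesis by (simp add: T_def)
qed

lemma dickman_transform_fixed_point_unique:
  fixes \<nu> \<mu> \<mu>' :: "'a::euclidean_space measure"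
  assumes "prob_space \<nu>" "sets \<nu> = sets borel" "0 < c"
    and "prob_space \<mu>" "sets \<mu> = sets borel" "dickman_transform c \<nu> \<mu> = \<mu>"
    and "prob_space \<mu>'" "sets \<mu>' = sets borel" "dickman_transform c \<nu> \<mu>' = \<mu>'"
  shows "\<mu> = \<mu>'"
proof (rule measure_eq_bounded_lipschitz)
  fix B L and g :: "'a \<Rightarrow> real" assume g: "bounded_lipschitz B L g"
  show "(\<integral>x. g x \<partial>\<mu>) = (\<integral>x. g x \<partial>\<mu>')"
    using fixed_point_integral_limit[OF assms(1,4,2,5,3,6) g]
      fixed_point_integral_limit[OF assms(1,7,2,8,3,9) g]
    by (rule LIMSEQ_unique)
qed fact+

text \<open>Splitting the uniform variable at \<open>p\<close>: below \<open>p\<close> it is \<open>p\<close> times a uniform variable, which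
  reproduces \<open>shrink_mean\<close> at the rescaled point; above \<open>p\<close>, the factor \<open>t powr (1 / c)\<close> is within
  \<open>1 - q\<close> of 1. Later \<open>p\<close> is the probability that a Poisson variable vanishes.\<close>

lemma shrink_mean_split:
  fixes g :: "'a::euclidean_space \<Rightarrow> real"
  assumes g: "bounded_lipschitz B L g" and c: "0 < c" and p: "0 < p" "p \<le> 1"
  defines "q \<equiv> p powr (1 / c)"
  shows "\<bar>shrink_mean c g w - p * shrink_mean c g (q *\<^sub>R w) - (1 - p) * g w\<bar>
    \<le> (1 - p) * (L * ((1 - q) * norm w))"
proof -
  have [measurable]: "g \<in> borel_measurable borel" by (rule bounded_lipschitz_measurable[OF g])
  note D = bounded_lipschitzD[OF g]
  define k where "k t = g (t powr (1 / c) *\<^sub>R w)" for t :: real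
  have [measurable]: "k \<in> borel_measurable borel" unfolding k_def by measurable
  have int: "set_integrable lborel {a..b} k" for a b
    unfolding set_integrable_def
  proof (rule Bochner_Integration.integrable_bound)
    show "integrable lborel (\<lambda>x. B * indicator {a..b::real} x)"
      by (intro integrable_mult_right integrable_real_indicator) (auto simp: emeasure_lborel_Icc_eq)
    show "AE x in lborel. norm (indicator {a..b} x *\<^sub>R k x) \<le> norm (B * indicator {a..b} x)"
      using D(1,4) by (intro AE_I2) (simp add: k_def split: split_indicator)
  qed measurable
  have 1: "shrink_mean c g w = (LBINT t:{0..1}. k t)"
    unfolding shrink_mean_def k_def by (rule uniform_01_integral) measurable
  have "p * shrink_mean c g (q *\<^sub>R w) = p * (LBINT t:{0..1}. g (t powr (1 / c) *\<^sub>R q *\<^sub>R w))"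
    unfolding shrink_mean_def by (subst uniform_01_integral) auto
  also have "(LBINT t:{0..1}. g (t powr (1 / c) *\<^sub>R q *\<^sub>R w)) = (LBINT t:{0..1}. k (p * t))"
    unfolding set_lebesgue_integral_def
    by (intro Bochner_Integration.integral_cong refl)
       (use p in \<open>auto simp: indicator_def k_def q_def powr_mult mult_ac\<close>)
  also have "p * \<dots> = \<bar>p\<bar> *\<^sub>R (\<integral>t. indicator {0..p} (0 + p * t) *\<^sub>R k (0 + p * t) \<partial>lborel)"
  proof -
    have "indicator {0..p} (p * t) = (indicator {0..1} t :: real)" for t
      using p by (auto simp: indicator_def zero_le_mult_iff mult_le_cancel_left1)
    then show ?thesis using p by (simp add: set_lebesgue_integral_def)
  qed
  also have "\<dots> = (LBINT t:{0..p}. k t)"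
    unfolding set_lebesgue_integral_def using p by (subst lborel_integral_real_affine[symmetric]) auto
  finally have 2: "p * shrink_mean c g (q *\<^sub>R w) = (LBINT t:{0..p}. k t)" .
  have 3: "(LBINT t:{0..1}. k t) = (LBINT t:{0..p}. k t) + (LBINT t:{p<..1}. k t)"
  proof -
    have "{0..1} = {0..p} \<union> {p<..1}" using p by auto
    then show ?thesis
      by (simp only:) (rule set_integral_Un, use int p in \<open>auto intro: set_integrable_subset[OF int[of 0 1]]\<close>)
  qed
  have int': "set_integrable lborel {p<..1} k"
    by (rule set_integrable_subset[OF int[of 0 1]]) (use p in auto)
  have c1: "set_integrable lborel {p<..1} (\<lambda>_. a)" for a :: real
    using p by (simp add: set_integrable_def)
  have mc: "(LBINT t:{p<..1}. a) = (1 - p) * a" for a :: real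
    using p by (simp add: set_lebesgue_integral_def)
  have "shrink_mean c g w - p * shrink_mean c g (q *\<^sub>R w) - (1 - p) * g w = (LBINT t:{p<..1}. k t - g w)"
    using int' c1 by (simp add: 1 2 3 mc set_integral_diff)
  also have "\<bar>\<dots>\<bar> \<le> (LBINT t:{p<..1}. \<bar>k t - g w\<bar>)"
    using set_integral_norm_bound[OF set_integral_diff(1)[OF int' c1], of "g w"] by simp
  also have "\<dots> \<le> (LBINT t:{p<..1}. L * ((1 - q) * norm w))"
  proof (rule set_integral_mono[OF set_integrable_abs[OF set_integral_diff(1)[OF int' c1]] c1])
    fix t assume t: "t \<in> {p<..1}"
    have "q \<le> t powr (1 / c)" unfolding q_def using t p c by (intro powr_mono2) auto
    moreover have "t powr (1 / c) \<le> 1" using t p c by (intro powr_le1) auto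
    ultimately have "norm (t powr (1 / c) *\<^sub>R w - w) \<le> (1 - q) * norm w"
      by (simp add: scaleR_left_diff_distrib[of _ 1 w, simplified, symmetric] mult_right_mono)
    then show "\<bar>k t - g w\<bar> \<le> L * ((1 - q) * norm w)"
      using D(2)[of "t powr (1 / c) *\<^sub>R w" w] D(3) mult_left_mono unfolding k_def by fastforce
  qed
  also have "\<dots> = (1 - p) * (L * ((1 - q) * norm w))" by (rule mc)
  finally show ?thesis .
qed

section \<open>Sums of marks over a finite configuration\<close>

lemma (in prob_space) expectation_add_mark:
  fixes g :: "'b::euclidean_space \<Rightarrow> real"
  assumes ind: "indep_var borel X borel Y" and \<nu>: "distr M borel Y = \<nu>"
    and g: "bounded_lipschitz B L g"
  shows "expectation (\<lambda>\<omega>. g (X \<omega> + Y \<omega>)) = expectation (\<lambda>\<omega>. shift_mean \<nu> g (X \<omega>))"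
proof -
  have X[measurable]: "X \<in> borel_measurable M" and Y[measurable]: "Y \<in> borel_measurable M"
    using ind indep_var_rv1 indep_var_rv2 by blast+
  have [measurable]: "g \<in> borel_measurable borel" by (rule bounded_lipschitz_measurable[OF g])
  interpret PX: prob_space "distr M borel X" by (rule prob_space_distr) fact
  interpret PY: prob_space "distr M borel Y" by (rule prob_space_distr) fact
  interpret PXY: pair_prob_space "distr M borel X" "distr M borel Y" ..
  have [measurable]: "shift_mean \<nu> g \<in> borel_measurable borel"
    using bounded_lipschitz_measurable[OF bounded_lipschitz_shift_mean[OF PY.prob_space_axioms _ g]]
    by (simp add: \<nu>[symmetric])
  have "expectation (\<lambda>\<omega>. g (X \<omega> + Y \<omega>))
      = (\<integral>(x, y). g (x + y) \<partial>distr M (borel \<Otimes>\<^sub>M borel) (\<lambda>\<omega>. (X \<omega>, Y \<omega>)))"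
    by (subst integral_distr) auto
  also have "\<dots> = (\<integral>(x, y). g (x + y) \<partial>(distr M borel X \<Otimes>\<^sub>M distr M borel Y))"
    using ind by (simp add: indep_var_distribution_eq)
  also have "\<dots> = (\<integral>x. (\<integral>y. g (x + y) \<partial>distr M borel Y) \<partial>distr M borel X)"
    by (rule PXY.integral_fst[symmetric], rule PXY.P.integrable_const_bound[of _ B])
       (use bounded_lipschitzD(1)[OF g] in auto)
  also have "\<dots> = (\<integral>x. shift_mean \<nu> g x \<partial>distr M borel X)" by (simp add: \<nu> shift_mean_def)
  also have "\<dots> = expectation (\<lambda>\<omega>. shift_mean \<nu> g (X \<omega>))" by (subst integral_distr) auto
  finally show ?thesis .
qed

lemma (in prob_space) indep_var_weighted_sum:
  fixes V :: "'i \<Rightarrow> 'a \<Rightarrow> 'b::euclidean_space"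
  assumes V: "indep_vars (\<lambda>_. borel) V UNIV" and K: "finite K" "k \<notin> K"
  shows "indep_var borel (\<lambda>\<omega>. \<Sum>i\<in>K. x i *\<^sub>R V i \<omega>) borel (V k)"
proof -
  have "indep_var
    borel ((\<lambda>f. \<Sum>i\<in>K. x i *\<^sub>R f i) \<circ> (\<lambda>\<omega>. restrict (\<lambda>i. V i \<omega>) K))
    borel ((\<lambda>f. f k) \<circ> (\<lambda>\<omega>. restrict (\<lambda>i. V i \<omega>) {k}))"
    using K by (intro indep_var_compose[OF indep_var_restrict[OF V]]) auto
  moreover have "(\<lambda>f. \<Sum>i\<in>K. x i *\<^sub>R f i) \<circ> (\<lambda>\<omega>. restrict (\<lambda>i. V i \<omega>) K)
      = (\<lambda>\<omega>. \<Sum>i\<in>K. x i *\<^sub>R V i \<omega>)"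
    by (auto cong: rev_conj_cong)
  moreover have "(\<lambda>f. f k) \<circ> (\<lambda>\<omega>. restrict (\<lambda>i. V i \<omega>) {k}) = V k" by auto
  ultimately show ?thesis by simp
qed

lemma bounded_lipschitz_shift_mean_iter:
  assumes "prob_space \<nu>" "sets \<nu> = sets borel" "bounded_lipschitz B L g"
  shows "bounded_lipschitz B L ((shift_mean \<nu> ^^ n) g)"
  by (induction n) (use assms bounded_lipschitz_shift_mean in auto)

text \<open>Integrating out one mark of weight 1 after the other turns each of them into one application of
  \<open>shift_mean\<close>.\<close>

lemma (in prob_space) expectation_unit_weights:
  fixes V :: "'i \<Rightarrow> 'a \<Rightarrow> 'b::euclidean_space"
  assumes V: "indep_vars (\<lambda>_. borel) V UNIV" and \<nu>: "\<And>k. distr M borel (V k) = \<nu>"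
    and K: "finite K0" "finite K1" "K0 \<inter> K1 = {}" and x: "\<And>k. k \<in> K0 \<Longrightarrow> x k = 1"
    and g: "bounded_lipschitz B L g"
  shows "expectation (\<lambda>\<omega>. g (\<Sum>k\<in>K0 \<union> K1. x k *\<^sub>R V k \<omega>))
    = expectation (\<lambda>\<omega>. (shift_mean \<nu> ^^ card K0) g (\<Sum>k\<in>K1. x k *\<^sub>R V k \<omega>))"
  using K(1,3) x g
proof (induction K0 arbitrary: g)
  case (insert k K0)
  have Vk: "V k \<in> borel_measurable M" using V by (simp add: indep_vars_def)
  have "prob_space \<nu>" unfolding \<nu>[of k, symmetric] by (rule prob_space_distr[OF Vk])
  moreover have "sets \<nu> = sets borel" unfolding \<nu>[of k, symmetric] by simp
  ultimately have bl: "bounded_lipschitz B L (shift_mean \<nu> g)"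
    using insert.prems by (intro bounded_lipschitz_shift_mean) auto
  have k: "k \<notin> K0 \<union> K1" "finite (K0 \<union> K1)" using insert K by auto
  have "expectation (\<lambda>\<omega>. g (\<Sum>k\<in>insert k K0 \<union> K1. x k *\<^sub>R V k \<omega>))
      = expectation (\<lambda>\<omega>. g ((\<Sum>k\<in>K0 \<union> K1. x k *\<^sub>R V k \<omega>) + V k \<omega>))"
    using k insert.prems(2)[of k] by (simp add: add.commute)
  also have "\<dots> = expectation (\<lambda>\<omega>. shift_mean \<nu> g (\<Sum>k\<in>K0 \<union> K1. x k *\<^sub>R V k \<omega>))"
    by (rule expectation_add_mark[OF indep_var_weighted_sum[OF V k(2,1)] \<nu> insert.prems(3)])
  also have "\<dots> = expectation (\<lambda>\<omega>. (shift_mean \<nu> ^^ card K0) (shift_mean \<nu> g) (\<Sum>k\<in>K1. x k *\<^sub>R V k \<omega>))"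
    using insert.prems bl by (intro insert.IH) auto
  finally show ?case using insert.hyps by (simp add: funpow_swap1)
qed simp

text \<open>The expectation of \<open>g\<close> at a sum of independent marks in which weight \<open>q ^ j\<close> occurs \<open>n j\<close> times, for
  \<open>j < m\<close>. The marks of weight 1 are integrated out first; a common factor \<open>q\<close> of the remaining weights
  is then moved into the test function, after which the layers are renumbered. In this form the
  removal of the outermost layer and the self-similarity under scaling by \<open>q\<close> are one recursion step.\<close>

fun layered ::
  "real \<Rightarrow> 'a::euclidean_space measure \<Rightarrow> ('a \<Rightarrow> real) \<Rightarrow> (nat \<Rightarrow> nat) \<Rightarrow> nat \<Rightarrow> real" where
  "layered q \<nu> g n 0 = g 0"
| "layered q \<nu> g n (Suc m) =
     layered q \<nu> (\<lambda>w. (shift_mean \<nu> ^^ n 0) g (q *\<^sub>R w)) (\<lambda>j. n (Suc j)) m"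

lemma layered_cong: "(\<And>j. j < m \<Longrightarrow> n j = n' j) \<Longrightarrow> layered q \<nu> g n m = layered q \<nu> g n' m"
proof (induction m arbitrary: g n n')
  case (Suc m)
  have "n 0 = n' 0" using Suc.prems by simp
  moreover have "layered q \<nu> h (\<lambda>j. n (Suc j)) m = layered q \<nu> h (\<lambda>j. n' (Suc j)) m" for h
    using Suc.prems by (intro Suc.IH) simp
  ultimately show ?case by simp
qed simp

lemma measurable_layered:
  assumes "\<And>j. j < m \<Longrightarrow> X j \<in> measurable N (count_space UNIV)"
  shows "(\<lambda>\<omega>. layered q \<nu> g (\<lambda>j. X j \<omega>) m) \<in> borel_measurable N"
  using assms
proof (induction m arbitrary: g X)
  case (Suc m)
  have "(\<lambda>\<omega>. layered q \<nu> (\<lambda>w. (shift_mean \<nu> ^^ n) g (q *\<^sub>R w)) (\<lambda>j. X (Suc j) \<omega>) m) \<in> borel_measurable N" for n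
    using Suc.prems by (intro Suc.IH) simp
  from measurable_compose_countable[OF this Suc.prems[of 0]] show ?case by simp
qed simp

lemma bounded_lipschitz_layer:
  assumes "prob_space \<nu>" "sets \<nu> = sets borel" "bounded_lipschitz B L g" "0 \<le> q" "q \<le> 1"
  shows "bounded_lipschitz B L (\<lambda>w. (shift_mean \<nu> ^^ n) g (q *\<^sub>R w))"
  using bounded_lipschitz_mono[OF bounded_lipschitz_scale[OF bounded_lipschitz_shift_mean_iter[OF assms(1-3)], of q]]
    assms bounded_lipschitzD(3)[OF assms(3)] by (simp add: mult_left_le)

lemma layered_bound:
  assumes "prob_space \<nu>" "sets \<nu> = sets borel" "bounded_lipschitz B L g" "0 \<le> q" "q \<le> 1"
  shows "\<bar>layered q \<nu> g n m\<bar> \<le> B"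
  using assms(3)
proof (induction m arbitrary: g n)
  case (Suc m)
  show ?case using Suc.IH[OF bounded_lipschitz_layer[OF assms(1,2) Suc.prems assms(4,5)]] by simp
qed (simp add: bounded_lipschitzD)

text \<open>The law of the sum depends on the labelling \<open>J\<close> only through the sizes of its fibres. This is what
  makes the enumeration of the Poisson points irrelevant.\<close>

lemma (in prob_space) expectation_eq_layered:
  fixes V :: "'i \<Rightarrow> 'a \<Rightarrow> 'b::euclidean_space"
  assumes V: "indep_vars (\<lambda>_. borel) V UNIV" and \<nu>: "\<And>k. distr M borel (V k) = \<nu>"
    and K: "finite K" "J ` K \<subseteq> {..<m}" and q: "0 \<le> q" "q \<le> 1"
    and g: "bounded_lipschitz B L g"
  shows "expectation (\<lambda>\<omega>. g (\<Sum>k\<in>K. q ^ J k *\<^sub>R V k \<omega>)) = layered q \<nu> g (\<lambda>j. card {k\<in>K. J k = j}) m"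
  using K g
proof (induction m arbitrary: g K J)
  case 0
  then show ?case by (simp add: prob_space)
next
  case (Suc m)
  define K0 where "K0 = {k\<in>K. J k = 0}"
  define K1 where "K1 = {k\<in>K. J k \<noteq> 0}"
  have KU: "K = K0 \<union> K1" "K0 \<inter> K1 = {}" "finite K0" "finite K1"
    using Suc.prems by (auto simp: K0_def K1_def)
  let ?h = "\<lambda>w. (shift_mean \<nu> ^^ card K0) g (q *\<^sub>R w)"
  have bl: "bounded_lipschitz B L ?h"
  proof -
    have Vk: "V k \<in> borel_measurable M" for k using V by (simp add: indep_vars_def)
    have "prob_space \<nu>" unfolding \<nu>[of undefined, symmetric] by (rule prob_space_distr[OF Vk])
    moreover have "sets \<nu> = sets borel" unfolding \<nu>[of undefined, symmetric] by simp
    ultimately show ?thesis using Suc.prems q by (intro bounded_lipschitz_layer) auto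
  qed
  have sum: "(\<Sum>k\<in>K1. q ^ J k *\<^sub>R V k \<omega>) = q *\<^sub>R (\<Sum>k\<in>K1. q ^ (J k - 1) *\<^sub>R V k \<omega>)" for \<omega>
    unfolding scaleR_sum_right
  proof (rule sum.cong)
    fix k assume "k \<in> K1"
    then have "J k = Suc (J k - 1)" by (simp add: K1_def)
    then show "q ^ J k *\<^sub>R V k \<omega> = q *\<^sub>R q ^ (J k - 1) *\<^sub>R V k \<omega>"
      by (metis power_Suc scaleR_scaleR)
  qed simp
  have "expectation (\<lambda>\<omega>. g (\<Sum>k\<in>K. q ^ J k *\<^sub>R V k \<omega>))
      = expectation (\<lambda>\<omega>. (shift_mean \<nu> ^^ card K0) g (\<Sum>k\<in>K1. q ^ J k *\<^sub>R V k \<omega>))"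
    unfolding KU(1) using KU Suc.prems(3) by (intro expectation_unit_weights[OF V \<nu>]) (auto simp: K0_def)
  also have "\<dots> = expectation (\<lambda>\<omega>. ?h (\<Sum>k\<in>K1. q ^ (J k - 1) *\<^sub>R V k \<omega>))"
    by (simp add: sum)
  also have "\<dots> = layered q \<nu> ?h (\<lambda>j. card {k\<in>K1. J k - 1 = j}) m"
    using KU Suc.prems bl by (intro Suc.IH) (auto simp: K1_def subset_iff)
  also have "(\<lambda>j. card {k\<in>K1. J k - 1 = j}) = (\<lambda>j. card {k\<in>K. J k = Suc j})"
    by (auto simp: K1_def fun_eq_iff intro!: arg_cong[where f=card])
  finally show ?case by (simp add: K0_def)
qed

section \<open>Independent identically distributed counts\<close>

lemma (in prob_space) expectation_layered_shift:
  fixes N :: "nat \<Rightarrow> 'a \<Rightarrow> nat"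
  assumes N: "indep_vars (\<lambda>_. count_space UNIV) N UNIV"
    and \<rho>: "\<And>j. distr M (count_space UNIV) (N j) = \<rho>"
  shows "expectation (\<lambda>\<omega>. layered q \<nu> g (\<lambda>j. N (Suc j) \<omega>) m)
    = expectation (\<lambda>\<omega>. layered q \<nu> g (\<lambda>j. N j \<omega>) m)"
proof (cases "m = 0")
  case False
  let ?P = "\<Pi>\<^sub>M j\<in>{..<m}. (count_space UNIV :: nat measure)"
  have rv[measurable]: "random_variable (count_space UNIV) (N j)" for j
    using N by (simp add: indep_vars_def)
  have m: "(\<lambda>n. layered q \<nu> g n m) \<in> borel_measurable ?P"
    by (rule measurable_layered) simp
  have ne: "{..<m} \<noteq> {}" using False by auto
  have law: "expectation (\<lambda>\<omega>. layered q \<nu> g (\<lambda>j. X j \<omega>) m)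
      = (\<integral>n. layered q \<nu> g n m \<partial>(\<Pi>\<^sub>M j\<in>{..<m}. \<rho>))"
    if X: "indep_vars (\<lambda>_. count_space UNIV) X {..<m}" "\<And>j. distr M (count_space UNIV) (X j) = \<rho>"
       "\<And>j. random_variable (count_space UNIV) (X j)" for X :: "nat \<Rightarrow> 'a \<Rightarrow> nat"
  proof -
    have "(\<Pi>\<^sub>M j\<in>{..<m}. \<rho>) = distr M ?P (\<lambda>\<omega>. \<lambda>j\<in>{..<m}. X j \<omega>)"
      using indep_vars_iff_distr_eq_PiM[of "{..<m}" X "\<lambda>_. count_space UNIV"] X ne by simp
    then have "(\<integral>n. layered q \<nu> g n m \<partial>(\<Pi>\<^sub>M j\<in>{..<m}. \<rho>))
        = expectation (\<lambda>\<omega>. layered q \<nu> g (\<lambda>j\<in>{..<m}. X j \<omega>) m)"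
      using X(3) m by (simp add: integral_distr)
    also have "\<dots> = expectation (\<lambda>\<omega>. layered q \<nu> g (\<lambda>j. X j \<omega>) m)"
      by (intro Bochner_Integration.integral_cong refl layered_cong) simp
    finally show ?thesis by simp
  qed
  have "indep_vars (\<lambda>_. count_space UNIV) (\<lambda>j. N (Suc j)) {..<m}"
  proof -
    have "indep_vars (\<lambda>j. Pi\<^sub>M {Suc j} (\<lambda>_. count_space UNIV))
        (\<lambda>j \<omega>. restrict (\<lambda>i. N i \<omega>) {Suc j}) {..<m}"
      by (rule indep_vars_restrict[OF N]) (auto simp: disjoint_family_on_def)
    then have "indep_vars (\<lambda>_. count_space UNIV)
        (\<lambda>j \<omega>. (\<lambda>x. x (Suc j)) (restrict (\<lambda>i. N i \<omega>) {Suc j})) {..<m}"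
      by (rule indep_vars_compose2) (rule measurable_component_singleton, simp)
    then show ?thesis by simp
  qed
  moreover have "indep_vars (\<lambda>_. count_space UNIV) N {..<m}" by (rule indep_vars_subset[OF N]) simp
  ultimately show ?thesis using law[of N] law[of "\<lambda>j. N (Suc j)"] \<rho> by simp
qed simp

text \<open>Self-similarity to first order. Conditioning on the outermost count, the layers below it are
  independent of it and distributed like all the layers, shifted by one. The counts 0 and 1 are kept
  exactly; larger counts contribute at most \<open>B\<close> times their probability, which is quadratically small
  for a Poisson variable of small mean.\<close>

lemma (in prob_space) expectation_layered_first_order:
  fixes N :: "nat \<Rightarrow> 'a \<Rightarrow> nat" and \<nu> :: "'b::euclidean_space measure"
  assumes N: "indep_vars (\<lambda>_. count_space UNIV) N UNIV"
    and \<rho>: "\<And>j. distr M (count_space UNIV) (N j) = \<rho>"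
    and \<nu>: "prob_space \<nu>" "sets \<nu> = sets borel" and g: "bounded_lipschitz B L g" and q: "0 \<le> q" "q \<le> 1"
  defines "p \<equiv> \<lambda>n. measure \<rho> {n}"
  shows "\<bar>expectation (\<lambda>\<omega>. layered q \<nu> g (\<lambda>j. N j \<omega>) (Suc m))
      - p 0 * expectation (\<lambda>\<omega>. layered q \<nu> (\<lambda>w. g (q *\<^sub>R w)) (\<lambda>j. N j \<omega>) m)
      - p 1 * expectation (\<lambda>\<omega>. layered q \<nu> (\<lambda>w. shift_mean \<nu> g (q *\<^sub>R w)) (\<lambda>j. N j \<omega>) m)\<bar>
    \<le> (1 - p 0 - p 1) * B"
proof -
  have rv[measurable]: "random_variable (count_space UNIV) (N j)" for j
    using N by (simp add: indep_vars_def)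
  define \<phi> where "\<phi> n \<omega> = layered q \<nu> (\<lambda>w. (shift_mean \<nu> ^^ n) g (q *\<^sub>R w)) (\<lambda>j. N (Suc j) \<omega>) m" for n \<omega>
  have \<phi>m[measurable]: "\<phi> n \<in> borel_measurable M" for n
    unfolding \<phi>_def by (rule measurable_layered) simp
  have \<phi>B: "\<bar>\<phi> n \<omega>\<bar> \<le> B" for n \<omega>
    unfolding \<phi>_def by (rule layered_bound[OF \<nu> bounded_lipschitz_layer[OF \<nu> g q] q])
  have \<phi>i: "integrable M (\<phi> n)" for n
    by (rule integrable_const_bound[of _ B]) (use \<phi>B in auto)
  define E where "E n = {\<omega>\<in>space M. N 0 \<omega> = n}" for n
  have Em[measurable]: "E n \<in> events" for n unfolding E_def by measurable
  have pE: "prob (E n) = p n" for n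
    unfolding p_def \<rho>[of 0, symmetric] E_def by (subst measure_distr) (auto intro!: arg_cong[where f=prob])
  have prod: "expectation (\<lambda>\<omega>. indicator (E n) \<omega> * \<phi> n \<omega>) = p n * expectation (\<phi> n)" for n
  proof -
    \<comment> \<open>The event depends on the coordinate 0 and the deeper layers on the coordinates \<open>1..m\<close>.\<close>
    have ind: "indep_var borel ((\<lambda>x. indicator {n} (x 0) :: real) \<circ> (\<lambda>\<omega>. restrict (\<lambda>j. N j \<omega>) {0}))
       borel ((\<lambda>x. layered q \<nu> (\<lambda>w. (shift_mean \<nu> ^^ n) g (q *\<^sub>R w)) (\<lambda>j. x (Suc j)) m)
         \<circ> (\<lambda>\<omega>. restrict (\<lambda>j. N j \<omega>) {1..m}))"
    proof (rule indep_var_compose[OF indep_var_restrict[OF N]])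
      show "(\<lambda>x. layered q \<nu> (\<lambda>w. (shift_mean \<nu> ^^ n) g (q *\<^sub>R w)) (\<lambda>j. x (Suc j)) m)
        \<in> borel_measurable (\<Pi>\<^sub>M j\<in>{1..m}. count_space UNIV)"
        by (rule measurable_layered) simp
      have "(\<lambda>x. x 0) \<in> (\<Pi>\<^sub>M j\<in>{0::nat}. count_space UNIV) \<rightarrow>\<^sub>M (count_space UNIV :: nat measure)"
        by (rule measurable_component_singleton) simp
      then show "(\<lambda>x. indicator {n} (x 0) :: real) \<in> borel_measurable (\<Pi>\<^sub>M j\<in>{0::nat}. count_space UNIV)"
        by (rule measurable_compose) simp
    qed auto
    have 1: "(\<lambda>x. indicator {n} (x 0) :: real) \<circ> (\<lambda>\<omega>. restrict (\<lambda>j. N j \<omega>) {0}) = (\<lambda>\<omega>. indicator {n} (N 0 \<omega>))"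
      by auto
    have 2: "(\<lambda>x. layered q \<nu> (\<lambda>w. (shift_mean \<nu> ^^ n) g (q *\<^sub>R w)) (\<lambda>j. x (Suc j)) m)
         \<circ> (\<lambda>\<omega>. restrict (\<lambda>j. N j \<omega>) {1..m}) = \<phi> n"
      by (auto simp: \<phi>_def fun_eq_iff intro!: layered_cong)
    have "expectation (\<lambda>\<omega>. indicator {n} (N 0 \<omega>) * \<phi> n \<omega>)
        = expectation (\<lambda>\<omega>. indicator {n} (N 0 \<omega>)) * expectation (\<phi> n)"
      by (rule indep_var_lebesgue_integral[OF ind[unfolded 1 2] _ \<phi>i])
         (rule integrable_const_bound[of _ 1], simp, rule measurable_compose[OF rv], simp)
    moreover have "expectation (\<lambda>\<omega>. indicator {n} (N 0 \<omega>)) = prob (E n)"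
    proof -
      have "expectation (\<lambda>\<omega>. indicator {n} (N 0 \<omega>)) = expectation (indicator (E n) :: _ \<Rightarrow> real)"
        by (intro Bochner_Integration.integral_cong refl) (auto simp: E_def indicator_def)
      then show ?thesis by simp
    qed
    moreover have "expectation (\<lambda>\<omega>. indicator {n} (N 0 \<omega>) * \<phi> n \<omega>) = expectation (\<lambda>\<omega>. indicator (E n) \<omega> * \<phi> n \<omega>)"
      by (intro Bochner_Integration.integral_cong refl) (auto simp: E_def indicator_def)
    ultimately show ?thesis by (simp add: pE)
  qed
  define F where "F \<omega> = layered q \<nu> g (\<lambda>j. N j \<omega>) (Suc m)" for \<omega>
  have F: "F \<omega> = \<phi> (N 0 \<omega>) \<omega>" for \<omega> by (simp add: F_def \<phi>_def)
  have Fm[measurable]: "F \<in> borel_measurable M" unfolding F_def by (rule measurable_layered) simp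
  have Fi: "integrable M F" by (rule integrable_const_bound[of _ B]) (use \<phi>B F in auto)
  have ii: "integrable M (\<lambda>\<omega>. indicator (E n) \<omega> * \<phi> n \<omega>)" for n
    using integrable_real_mult_indicator[OF Em \<phi>i] by (simp add: mult.commute)
  have Ind: "integrable M (indicator (E n) :: _ \<Rightarrow> real)" for n
    by (rule integrable_real_indicator) (auto simp: less_top[symmetric])
  then have Ei: "integrable M (\<lambda>\<omega>. B * (1 - indicator (E 0) \<omega> - indicator (E 1) \<omega>))"
    by (intro integrable_mult_right Bochner_Integration.integrable_diff integrable_const)
  have "expectation F - p 0 * expectation (\<phi> 0) - p 1 * expectation (\<phi> 1)
      = expectation (\<lambda>\<omega>. F \<omega> - indicator (E 0) \<omega> * \<phi> 0 \<omega> - indicator (E 1) \<omega> * \<phi> 1 \<omega>)"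
    using Fi ii prod by simp
  also have "\<bar>\<dots>\<bar> \<le> expectation (\<lambda>\<omega>. \<bar>F \<omega> - indicator (E 0) \<omega> * \<phi> 0 \<omega> - indicator (E 1) \<omega> * \<phi> 1 \<omega>\<bar>)"
    by (rule integral_abs_bound)
  also have "\<dots> \<le> expectation (\<lambda>\<omega>. B * (1 - indicator (E 0) \<omega> - indicator (E 1) \<omega>))"
  proof (rule integral_mono)
    fix \<omega> assume "\<omega> \<in> space M"
    then show "\<bar>F \<omega> - indicator (E 0) \<omega> * \<phi> 0 \<omega> - indicator (E 1) \<omega> * \<phi> 1 \<omega>\<bar>
        \<le> B * (1 - indicator (E 0) \<omega> - indicator (E 1) \<omega>)"
      using \<phi>B[of "N 0 \<omega>" \<omega>] by (auto simp: F E_def indicator_def)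
  qed (use Fi ii Ei in auto)
  also have "\<dots> = B * (1 - p 0 - p 1)" using Ind by (simp add: pE prob_space)
  finally have *: "\<bar>expectation F - p 0 * expectation (\<phi> 0) - p 1 * expectation (\<phi> 1)\<bar> \<le> B * (1 - p 0 - p 1)" .
  have "expectation (\<phi> n) = expectation (\<lambda>\<omega>. layered q \<nu> (\<lambda>w. (shift_mean \<nu> ^^ n) g (q *\<^sub>R w)) (\<lambda>j. N j \<omega>) m)" for n
    unfolding \<phi>_def by (rule expectation_layered_shift[OF N \<rho>])
  from this[of 0] this[of 1] * show ?thesis by (simp add: F_def[abs_def] mult.commute)
qed

section \<open>Counts of the Poisson process on a geometric grid\<close>

text \<open>The intensity is invariant under scaling, since the mass depends only on \<open>b / a\<close>. Cells of a
  geometric grid therefore all have the same mass.\<close>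

lemma emeasure_dickman_intensity:
  assumes "0 < c" "0 < a" "a \<le> b"
  shows "emeasure (dickman_intensity c) {a<..b} = ennreal (c * ln (b / a))"
proof -
  have S: "{a<..b} \<in> sets (restrict_space lborel {0<..})"
    using assms by (auto simp: sets_restrict_space image_iff intro!: bexI[of _ "{a<..b}"])
  have "emeasure (dickman_intensity c) {a<..b}
      = (\<integral>\<^sup>+t. ennreal (c / t) * indicator {a<..b} t \<partial>restrict_space lborel {0<..})"
    unfolding dickman_intensity_def by (rule emeasure_density[OF _ S]) (simp add: measurable_restrict_space1)
  also have "\<dots> = (\<integral>\<^sup>+t. ennreal (c / t) * indicator {a<..b} t * indicator {0<..} t \<partial>lborel)"
    by (rule nn_integral_restrict_space) simp
  also have "\<dots> = (\<integral>\<^sup>+t. ennreal (c / t) * indicator {a..b} t \<partial>lborel)"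
  proof (rule nn_integral_cong_AE)
    show "AE t in lborel. ennreal (c / t) * indicator {a<..b} t * indicator {0<..} t
        = ennreal (c / t) * indicator {a..b} t"
      using AE_lborel_singleton[of a] by eventually_elim (use assms in \<open>auto simp: indicator_def\<close>)
  qed
  also have "\<dots> = ennreal (c * ln b - c * ln a)"
  proof (rule nn_integral_FTC_Icc)
    show "((\<lambda>t. c * ln t) has_real_derivative c / x) (at x)" if "x \<in> {a..b}" for x
      using that assms by (auto intro!: derivative_eq_intros)
  qed (use assms in auto)
  finally show ?thesis using assms by (simp add: ln_div right_diff_distrib)
qed

lemma borel_measurable_integral_count_space:
  fixes X :: "nat \<Rightarrow> 'w \<Rightarrow> 'a::euclidean_space"
  assumes "\<And>k. X k \<in> borel_measurable N"
  shows "(\<lambda>\<omega>. \<integral>k. X k \<omega> \<partial>count_space UNIV) \<in> borel_measurable N"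
proof -
  have "(\<lambda>x. X (snd x) (fst x)) \<in> borel_measurable (N \<Otimes>\<^sub>M count_space UNIV)"
    by (rule measurable_compose_countable[where f="\<lambda>k x. X k (fst x)"])
       (use assms in \<open>auto intro: measurable_compose[OF measurable_fst]\<close>)
  then have "case_prod (\<lambda>\<omega> k. X k \<omega>) \<in> borel_measurable (N \<Otimes>\<^sub>M count_space UNIV)"
    by (simp add: case_prod_unfold)
  then show ?thesis
    by (rule sigma_finite_measure.borel_measurable_lebesgue_integral[OF sigma_finite_measure_count_space])
qed

lemma poisson_mean:
  assumes "0 < l"
  shows "(\<integral>\<^sup>+n. of_nat n \<partial>measure_pmf (poisson_pmf l)) = ennreal l"
proof -
  have "(\<lambda>n. l * exp (- l) * (l ^ n /\<^sub>R fact n)) sums (l * exp (- l) * exp l)"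
    by (intro sums_mult exp_converges)
  moreover have "l * exp (- l) * (l ^ n /\<^sub>R fact n) = l ^ Suc n / fact (Suc n) * exp (- l) * real (Suc n)" for n
    by (simp add: field_simps del: of_nat_Suc)
  ultimately have "(\<lambda>n. l ^ Suc n / fact (Suc n) * exp (- l) * real (Suc n)) sums l"
    by (simp add: mult.assoc exp_add[symmetric] del: of_nat_Suc fact_Suc power_Suc)
  from sums_Suc[OF this] have s: "(\<lambda>n. l ^ n / fact n * exp (- l) * real n) sums l" by simp
  have "(\<integral>\<^sup>+n. of_nat n \<partial>measure_pmf (poisson_pmf l))
      = (\<Sum>n. ennreal (l ^ n / fact n * exp (- l) * real n))"
    using assms
    by (simp add: nn_integral_measure_pmf nn_integral_count_space_nat ennreal_of_nat_eq_real_of_nat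
      ennreal_mult[symmetric] del: ennreal_mult'')
  also have "\<dots> = ennreal l" using s assms by (intro suminf_ennreal_eq) auto
  finally show ?thesis .
qed

locale dickman =
  fixes M :: "'w measure" and c :: real and \<nu> :: "'a::euclidean_space measure"
    and Z :: "nat \<Rightarrow> 'w \<Rightarrow> real" and V :: "nat \<Rightarrow> 'w \<Rightarrow> 'a"
  assumes c_pos: "0 < c" and data: "dickman_data M c \<nu> Z V" and unit: "AE u in \<nu>. norm u = 1"
begin

sublocale prob_space M
  using data by (simp add: dickman_data_def)

lemma Z_measurable [measurable]: "Z k \<in> borel_measurable M"
  and Z_pos: "\<omega> \<in> space M \<Longrightarrow> 0 < Z k \<omega>"
  and V_indep: "indep_vars (\<lambda>_. borel) V UNIV"
  and V_law: "distr M borel (V k) = \<nu>"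
  and VZ_indep: "indep_rv M (PiM UNIV (\<lambda>_. borel)) (\<lambda>\<omega> k. V k \<omega>) (PiM UNIV (\<lambda>_. borel)) (\<lambda>\<omega> k. Z k \<omega>)"
  and poisson: "poisson_process M (\<lambda>\<omega>. point_measure (restrict_space borel {0<..}) (\<lambda>k. Z k \<omega>)) (dickman_intensity c)"
  using data by (auto simp: dickman_data_def)

lemma V_measurable [measurable]: "V k \<in> borel_measurable M"
  using V_indep by (simp add: indep_vars_def)

lemma sets_\<nu>: "sets \<nu> = sets borel"
  unfolding V_law[of undefined, symmetric] by simp

lemma prob_space_\<nu>: "prob_space \<nu>"
  unfolding V_law[of undefined, symmetric] by (rule prob_space_distr) simp

lemma AE_norm_V: "AE \<omega> in M. \<forall>k. norm (V k \<omega>) = 1"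
  unfolding AE_all_countable
proof
  fix k
  have "AE u in distr M borel (V k). norm u = 1" unfolding V_law by (rule unit)
  then show "AE \<omega> in M. norm (V k \<omega>) = 1" by (subst (asm) AE_distr_iff) auto
qed

definition mark_sum :: "(real \<Rightarrow> real) \<Rightarrow> 'w \<Rightarrow> 'a" where
  "mark_sum a \<omega> = (\<integral>k. a (Z k \<omega>) *\<^sub>R V k \<omega> \<partial>count_space UNIV)"

lemma measurable_mark_sum [measurable]:
  "a \<in> borel_measurable borel \<Longrightarrow> mark_sum a \<in> borel_measurable M"
  unfolding mark_sum_def[abs_def] by (rule borel_measurable_integral_count_space) simp

lemma dickman_vector_eq:
  "dickman_vector Z V \<omega>
    = (\<integral>k. indicator (cball 0 1) (Z k \<omega> *\<^sub>R V k \<omega>) *\<^sub>R (Z k \<omega> *\<^sub>R V k \<omega>) \<partial>count_space UNIV)"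
  unfolding dickman_vector_def marked_process_def point_measure_def set_lebesgue_integral_def
proof (rule integral_distr)
  have "indicator (cball 0 1) \<in> borel_measurable (borel :: 'a measure)"
    by (rule borel_measurable_indicator) simp
  then show "(\<lambda>x::'a. indicator (cball 0 1) x *\<^sub>R x) \<in> borel_measurable borel"
    by (rule borel_measurable_scaleR) simp
qed simp

lemma measurable_dickman_vector [measurable]: "dickman_vector Z V \<in> borel_measurable M"
  unfolding dickman_vector_eq[abs_def]
proof (rule borel_measurable_integral_count_space)
  fix k
  have 1: "(\<lambda>\<omega>. Z k \<omega> *\<^sub>R V k \<omega>) \<in> borel_measurable M" by measurable
  have "indicator (cball 0 1) \<in> borel_measurable (borel :: 'a measure)"
    by (rule borel_measurable_indicator) simp
  then have "(\<lambda>x::'a. indicator (cball 0 1) x *\<^sub>R x) \<in> borel_measurable borel"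
    by (rule borel_measurable_scaleR) simp
  from measurable_compose[OF 1 this]
  show "(\<lambda>\<omega>. indicator (cball 0 1) (Z k \<omega> *\<^sub>R V k \<omega>) *\<^sub>R (Z k \<omega> *\<^sub>R V k \<omega>)) \<in> borel_measurable M" .
qed

definition trunc :: "real \<Rightarrow> real" where "trunc t = (if t \<le> 1 then t else 0)"

lemma measurable_trunc [measurable]: "trunc \<in> borel_measurable borel"
  unfolding trunc_def[abs_def] by measurable

text \<open>The marks lie on the unit sphere almost surely, so that the point \<open>Z k * V k\<close> is in the unit ball
  exactly if \<open>Z k \<le> 1\<close>.\<close>

lemma dickman_vector_AE: "AE \<omega> in M. dickman_vector Z V \<omega> = mark_sum trunc \<omega>"
  using AE_norm_V AE_space
proof eventually_elim
  case (elim \<omega>)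
  have "indicator (cball 0 1) (Z k \<omega> *\<^sub>R V k \<omega>) *\<^sub>R (Z k \<omega> *\<^sub>R V k \<omega>) = trunc (Z k \<omega>) *\<^sub>R V k \<omega>" for k
    using elim Z_pos[of \<omega> k] by (auto simp: trunc_def indicator_def)
  then show ?case by (simp only: dickman_vector_eq mark_sum_def)
qed

end

text \<open>The parameter \<open>l\<close> is the mass of one cell; it is sent to 0 at the end. The ratio \<open>q\<close> of the grid is
  determined by \<open>l = c * ln (1 / q)\<close>.\<close>

locale dickman_grid = dickman M c \<nu> Z V
  for M :: "'w measure" and c :: real and \<nu> :: "'a::euclidean_space measure"
    and Z :: "nat \<Rightarrow> 'w \<Rightarrow> real" and V :: "nat \<Rightarrow> 'w \<Rightarrow> 'a" +
  fixes l :: real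
  assumes l_pos: "0 < l"
begin

definition q :: real where "q = exp (- l / c)"

lemma q_bounds: "0 < q" "q < 1"
  using c_pos l_pos by (auto simp: q_def)

definition cell :: "nat \<Rightarrow> real set" where "cell j = {q ^ Suc j<..q ^ j}"

lemma cell_unique: "t \<in> cell i \<Longrightarrow> t \<in> cell j \<Longrightarrow> i = j"
proof (rule ccontr)
  have *: False if "t \<in> cell i" "t \<in> cell j" "i < j" for i j
  proof -
    have "q ^ j \<le> q ^ Suc i" using that q_bounds by (intro power_decreasing) auto
    then show False using that by (auto simp: cell_def)
  qed
  assume "t \<in> cell i" "t \<in> cell j" "i \<noteq> j"
  then show False using *[of i j] *[of j i] by (cases "i < j") auto
qed

lemma cell_bounds:
  assumes "t \<in> cell j"
  shows "0 < t \<and> t \<le> 1"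
proof -
  have "0 < q ^ Suc j" "q ^ j \<le> 1" using q_bounds by (simp_all add: power_le_one)
  with assms show ?thesis unfolding cell_def by (auto simp del: power_Suc)
qed

lemma cell_exists:
  assumes "0 < t" "t \<le> 1"
  obtains j where "t \<in> cell j"
proof -
  have ex: "\<exists>j. q ^ Suc j < t"
  proof -
    obtain j where "q ^ j < t" using real_arch_pow_inv[OF assms(1)] q_bounds by auto
    moreover have "q ^ Suc j \<le> q ^ j" using q_bounds by (intro power_decreasing) auto
    ultimately show ?thesis by (meson le_less_trans)
  qed
  define j where "j = (LEAST j. q ^ Suc j < t)"
  have "q ^ Suc j < t" unfolding j_def using ex by (rule LeastI_ex)
  moreover have "t \<le> q ^ j"
  proof (cases j)
    case (Suc i)
    then have "\<not> q ^ Suc i < t" using not_less_Least[of i "\<lambda>j. q ^ Suc j < t"] by (simp add: j_def)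
    then show ?thesis by (simp add: Suc)
  qed (use assms in simp)
  ultimately show thesis using that by (simp add: cell_def)
qed

lemma measurable_cell [measurable]: "cell j \<in> sets borel"
  by (simp add: cell_def)

lemma cell_intensity: "cell j \<in> sets (dickman_intensity c)" "emeasure (dickman_intensity c) (cell j) = ennreal l"
proof -
  show "cell j \<in> sets (dickman_intensity c)"
    using cell_bounds
    by (auto simp: dickman_intensity_def sets_restrict_space image_iff intro!: bexI[of _ "cell j"])
  have "q ^ j / q ^ Suc j = 1 / q" using q_bounds by (simp add: field_simps)
  then have "c * ln (q ^ j / q ^ Suc j) = l" using c_pos by (simp add: q_def ln_div)
  moreover have "q ^ Suc j \<le> q ^ j" using q_bounds by (intro power_decreasing) auto
  ultimately show "emeasure (dickman_intensity c) (cell j) = ennreal l"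
    using emeasure_dickman_intensity[OF c_pos, of "q ^ Suc j" "q ^ j"] q_bounds by (simp add: cell_def)
qed

definition N :: "nat \<Rightarrow> 'w \<Rightarrow> nat" where "N j \<omega> = card {k. Z k \<omega> \<in> cell j}"

text \<open>The number of points in a cell, with the value infinity where \<open>N\<close>, as the cardinality of an
  infinite set, is 0. The Poisson property speaks about \<open>ecount\<close>, and the two agree almost surely.\<close>

definition ecount :: "nat \<Rightarrow> 'w \<Rightarrow> ennreal" where
  "ecount j \<omega> = emeasure (count_space UNIV) {k. Z k \<omega> \<in> cell j}"

lemma ecount_eq:
  assumes "\<omega> \<in> space M"
  shows "emeasure (point_measure (restrict_space borel {0<..}) (\<lambda>k. Z k \<omega>)) (cell j) = ecount j \<omega>"
proof -
  have "(\<lambda>k. Z k \<omega>) \<in> count_space UNIV \<rightarrow>\<^sub>M restrict_space borel {0<..}"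
    using Z_pos[OF assms] by (auto simp: space_restrict_space)
  moreover have "cell j \<in> sets (restrict_space borel {0<..})"
    using cell_intensity(1)[of j]
    by (simp add: dickman_intensity_def sets_restrict_space)
  ultimately show ?thesis
    unfolding point_measure_def ecount_def by (subst emeasure_distr) (auto intro!: arg_cong2[where f=emeasure])
qed

lemma N_ecount: "N j \<omega> = nat \<lfloor>enn2real (ecount j \<omega>)\<rfloor>"
  by (cases "finite {k. Z k \<omega> \<in> cell j}") (auto simp: N_def ecount_def emeasure_count_space)

lemma measurable_ecount [measurable]: "ecount j \<in> borel_measurable M"
proof -
  have "(\<lambda>\<omega>. emeasure (point_measure (restrict_space borel {0<..}) (\<lambda>k. Z k \<omega>)) (cell j)) \<in> borel_measurable M"
    using poisson cell_intensity(1)[of j] by (auto simp: poisson_process_def)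
  then show ?thesis by (simp add: ecount_eq cong: measurable_cong)
qed

lemma prob_ecount: "prob {\<omega>\<in>space M. ecount j \<omega> = of_nat n} = l ^ n / fact n * exp (- l)"
proof -
  have "measure (dickman_intensity c) (cell j) = l"
    using cell_intensity(2)[of j] l_pos by (simp add: measure_def)
  then have "prob {\<omega>\<in>space M. emeasure (point_measure (restrict_space borel {0<..}) (\<lambda>k. Z k \<omega>)) (cell j) = of_nat n}
      = l ^ n / fact n * exp (- l)"
    using poisson cell_intensity[of j] by (auto simp: poisson_process_def)
  then show ?thesis by (simp add: ecount_eq cong: conj_cong)
qed

lemma ecount_indep: "indep_vars (\<lambda>_. borel) ecount {..<n::nat}"
proof -
  let ?\<eta> = "\<lambda>j \<omega>. emeasure (point_measure (restrict_space borel {0<..}) (\<lambda>k. Z k \<omega>)) (cell j)"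
  have "cell ` {..<n} \<subseteq> sets (dickman_intensity c)" using cell_intensity(1) by auto
  moreover have "disjoint_family_on cell {..<n}"
    unfolding disjoint_family_on_def using cell_unique by blast
  ultimately have \<eta>: "indep_vars (\<lambda>_. borel) ?\<eta> {..<n}"
    using poisson unfolding poisson_process_def by blast
  have eq: "?\<eta> j -` A \<inter> space M = ecount j -` A \<inter> space M" for j A
    using ecount_eq by auto
  show ?thesis
    unfolding indep_vars_def2
  proof
    show "indep_sets (\<lambda>i. {ecount i -` A \<inter> space M |A. A \<in> sets borel}) {..<n}"
      using \<eta> unfolding indep_vars_def2 eq by blast
  qed simp
qed

lemma N_indep: "indep_vars (\<lambda>_. count_space UNIV) N UNIV"
proof -
  have fin: "indep_vars (\<lambda>_. count_space UNIV) N {..<n}" for n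
    unfolding N_ecount[abs_def]
    by (rule indep_vars_compose2[OF ecount_indep]) measurable
  have rv: "random_variable (count_space UNIV) (N j)" for j
    using fin[of "Suc j"] unfolding indep_vars_def by blast
  show ?thesis
    unfolding indep_vars_def
  proof (intro conjI ballI rv, subst indep_sets_finite_index_sets, intro allI impI)
    fix J :: "nat set" assume "finite J"
    then obtain n where "J \<subseteq> {..<n}" using finite_nat_iff_bounded by auto
    then show "indep_sets (\<lambda>i. sigma_sets (space M) {N i -` A \<inter> space M |A. A \<in> sets (count_space UNIV)}) J"
      using fin[of n] unfolding indep_vars_def by (blast intro: indep_sets_mono_index)
  qed
qed

text \<open>The Poisson probabilities of the finite values add up to 1.\<close>

lemma AE_ecount_finite: "AE \<omega> in M. ecount j \<omega> = of_nat (N j \<omega>)"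
proof -
  define E where "E n = {\<omega>\<in>space M. ecount j \<omega> = of_nat n}" for n
  have [measurable]: "E n \<in> events" for n unfolding E_def by measurable
  have "(\<lambda>n. prob (E n)) sums prob (\<Union>n. E n)"
    by (rule finite_measure_UNION) (auto simp: E_def disjoint_family_on_def)
  moreover have "(\<lambda>n. prob (E n)) sums 1"
  proof -
    have "(\<lambda>n. exp (- l) * (l ^ n /\<^sub>R fact n)) sums (exp (- l) * exp l)"
      by (intro sums_mult exp_converges)
    then show ?thesis
      by (simp add: E_def prob_ecount exp_minus field_simps)
  qed
  ultimately have "prob (\<Union>n. E n) = 1" by (rule sums_unique2)
  then have "AE \<omega> in M. \<omega> \<in> (\<Union>n. E n)" by (intro AE_prob_1)
  then show ?thesis
    by eventually_elim (auto simp: E_def N_ecount)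
qed

lemma N_law: "distr M (count_space UNIV) (N j) = measure_pmf (poisson_pmf l)"
proof (rule measure_eqI_countable[of _ UNIV])
  have rv[measurable]: "random_variable (count_space UNIV) (N j)"
    using N_indep by (simp add: indep_vars_def)
  fix n
  have "emeasure (distr M (count_space UNIV) (N j)) {n} = prob {\<omega>\<in>space M. N j \<omega> = n}"
    by (subst emeasure_distr) (auto simp: emeasure_eq_measure intro!: arg_cong[where f=prob])
  also have "prob {\<omega>\<in>space M. N j \<omega> = n} = prob {\<omega>\<in>space M. ecount j \<omega> = of_nat n}"
    using AE_ecount_finite[of j] by (intro measure_eq_AE) auto
  also have "\<dots> = pmf (poisson_pmf l) n"
    using l_pos by (simp add: prob_ecount)
  finally show "emeasure (distr M (count_space UNIV) (N j)) {n} = emeasure (measure_pmf (poisson_pmf l)) {n}"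
    by (simp add: emeasure_pmf_single)
qed auto

lemma expectation_ecount: "(\<integral>\<^sup>+\<omega>. ecount j \<omega> \<partial>M) = ennreal l"
proof -
  have rv[measurable]: "random_variable (count_space UNIV) (N j)"
    using N_indep by (simp add: indep_vars_def)
  have "(\<integral>\<^sup>+\<omega>. ecount j \<omega> \<partial>M) = (\<integral>\<^sup>+\<omega>. of_nat (N j \<omega>) \<partial>M)"
    using AE_ecount_finite by (rule nn_integral_cong_AE)
  also have "\<dots> = (\<integral>\<^sup>+n. of_nat n \<partial>distr M (count_space UNIV) (N j))"
    by (subst nn_integral_distr) auto
  finally show ?thesis using l_pos by (simp add: N_law poisson_mean)
qed

section \<open>Step functions on the grid\<close>

text \<open>Step functions with infinitely many steps, constant on each cell, serve as majorants. Their sums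
  over the Poisson points have an explicit expectation, so that all error estimates reduce to sums
  of numerical series.\<close>

definition grid_step :: "(nat \<Rightarrow> real) \<Rightarrow> real \<Rightarrow> ennreal" where
  "grid_step \<beta> t = (\<Sum>j. ennreal (\<beta> j) * indicator (cell j) t)"

lemma measurable_grid_step [measurable]: "grid_step \<beta> \<in> borel_measurable borel"
  unfolding grid_step_def[abs_def] by measurable

lemma grid_step_ge: "t \<in> cell j \<Longrightarrow> ennreal (\<beta> j) \<le> grid_step \<beta> t"
  unfolding grid_step_def using sum_le_suminf[of "\<lambda>j. ennreal (\<beta> j) * indicator (cell j) t" "{j}"] by simp

lemma campbell_grid_step:
  assumes "\<And>j. 0 \<le> \<beta> j" "\<beta> sums b"
  shows "(\<integral>\<^sup>+\<omega>. (\<integral>\<^sup>+k. grid_step \<beta> (Z k \<omega>) \<partial>count_space UNIV) \<partial>M) = ennreal (l * b)"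
proof -
  have e: "ecount j \<omega> = (\<integral>\<^sup>+k. indicator (cell j) (Z k \<omega>) \<partial>count_space UNIV)" for j \<omega>
  proof -
    have "ecount j \<omega> = (\<integral>\<^sup>+k. indicator {k. Z k \<omega> \<in> cell j} k \<partial>count_space UNIV)"
      unfolding ecount_def by (rule nn_integral_indicator[symmetric]) simp
    then show ?thesis by (simp add: indicator_def)
  qed
  have "(\<integral>\<^sup>+k. grid_step \<beta> (Z k \<omega>) \<partial>count_space UNIV) = (\<Sum>j. ennreal (\<beta> j) * ecount j \<omega>)" for \<omega>
    unfolding grid_step_def e by (subst nn_integral_suminf) (auto simp: nn_integral_cmult)
  then have "(\<integral>\<^sup>+\<omega>. (\<integral>\<^sup>+k. grid_step \<beta> (Z k \<omega>) \<partial>count_space UNIV) \<partial>M)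
      = (\<Sum>j. ennreal (\<beta> j) * ennreal l)"
    by (simp add: nn_integral_suminf nn_integral_cmult expectation_ecount)
  also have "\<dots> = (\<Sum>j. ennreal (l * \<beta> j))"
    using assms l_pos by (simp add: ennreal_mult mult.commute)
  also have "\<dots> = ennreal (l * b)"
    using assms l_pos by (intro suminf_ennreal_eq sums_mult) auto
  finally show ?thesis .
qed

text \<open>For such functions the bound \<open>l * b\<close> controls the expected total weight of the points, and hence
  the expected norm of the corresponding sum of marks.\<close>

definition dominated :: "(real \<Rightarrow> real) \<Rightarrow> real \<Rightarrow> bool" where
  "dominated a b \<longleftrightarrow> a \<in> borel_measurable borel \<and>
     (\<exists>\<beta>. (\<forall>j. 0 \<le> \<beta> j) \<and> \<beta> sums b \<and> (\<forall>t>0. ennreal \<bar>a t\<bar> \<le> grid_step \<beta> t))"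

lemma nn_integral_dominated:
  assumes "dominated a b"
  shows "(\<integral>\<^sup>+\<omega>. (\<integral>\<^sup>+k. ennreal \<bar>a (Z k \<omega>)\<bar> \<partial>count_space UNIV) \<partial>M) \<le> ennreal (l * b)"
proof -
  obtain \<beta> where \<beta>: "\<And>j. 0 \<le> \<beta> j" "\<beta> sums b" "\<And>t. 0 < t \<Longrightarrow> ennreal \<bar>a t\<bar> \<le> grid_step \<beta> t"
    using assms by (auto simp: dominated_def)
  have "(\<integral>\<^sup>+\<omega>. (\<integral>\<^sup>+k. ennreal \<bar>a (Z k \<omega>)\<bar> \<partial>count_space UNIV) \<partial>M)
      \<le> (\<integral>\<^sup>+\<omega>. (\<integral>\<^sup>+k. grid_step \<beta> (Z k \<omega>) \<partial>count_space UNIV) \<partial>M)"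
    by (intro nn_integral_mono) (use \<beta>(3) Z_pos in auto)
  then show ?thesis using campbell_grid_step[OF \<beta>(1,2)] by simp
qed

lemma AE_integrable_dominated:
  assumes "dominated a b"
  shows "AE \<omega> in M. integrable (count_space UNIV) (\<lambda>k. a (Z k \<omega>) *\<^sub>R V k \<omega>)"
proof -
  have [measurable]: "a \<in> borel_measurable borel" using assms by (simp add: dominated_def)
  have "(\<lambda>\<omega>. \<integral>\<^sup>+k. ennreal \<bar>a (Z k \<omega>)\<bar> \<partial>count_space UNIV) \<in> borel_measurable M"
    by (simp add: nn_integral_count_space_nat)
  moreover have "(\<integral>\<^sup>+\<omega>. (\<integral>\<^sup>+k. ennreal \<bar>a (Z k \<omega>)\<bar> \<partial>count_space UNIV) \<partial>M) \<noteq> \<infinity>"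
    using nn_integral_dominated[OF assms] by (auto simp: top_unique)
  ultimately have "AE \<omega> in M. (\<integral>\<^sup>+k. ennreal \<bar>a (Z k \<omega>)\<bar> \<partial>count_space UNIV) \<noteq> \<infinity>"
    by (rule nn_integral_PInf_AE)
  then show ?thesis using AE_norm_V
    by eventually_elim (auto intro!: integrableI_bounded simp: less_top)
qed

text \<open>A coupling estimate: both sums use the same points and the same marks of norm 1, so that the
  distance is at most the total difference of the weights.\<close>

lemma mark_sum_dist:
  assumes "dominated a b" "dominated a' b'" "dominated (\<lambda>t. a t - a' t) d"
  shows "integrable M (\<lambda>\<omega>. norm (mark_sum a \<omega> - mark_sum a' \<omega>))"
    and "expectation (\<lambda>\<omega>. norm (mark_sum a \<omega> - mark_sum a' \<omega>)) \<le> l * d"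
proof -
  have [measurable]: "a \<in> borel_measurable borel" "a' \<in> borel_measurable borel"
    using assms by (auto simp: dominated_def)
  have d: "0 \<le> d" using assms(3) suminf_nonneg sums_summable sums_unique unfolding dominated_def by metis
  have "(\<integral>\<^sup>+\<omega>. norm (mark_sum a \<omega> - mark_sum a' \<omega>) \<partial>M)
      \<le> (\<integral>\<^sup>+\<omega>. (\<integral>\<^sup>+k. ennreal \<bar>a (Z k \<omega>) - a' (Z k \<omega>)\<bar> \<partial>count_space UNIV) \<partial>M)"
  proof (rule nn_integral_mono_AE)
    show "AE \<omega> in M. ennreal (norm (mark_sum a \<omega> - mark_sum a' \<omega>))
        \<le> (\<integral>\<^sup>+k. ennreal \<bar>a (Z k \<omega>) - a' (Z k \<omega>)\<bar> \<partial>count_space UNIV)"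
      using AE_integrable_dominated[OF assms(1)] AE_integrable_dominated[OF assms(2)] AE_norm_V
    proof eventually_elim
      case (elim \<omega>)
      have "mark_sum a \<omega> - mark_sum a' \<omega>
          = (\<integral>k. a (Z k \<omega>) *\<^sub>R V k \<omega> - a' (Z k \<omega>) *\<^sub>R V k \<omega> \<partial>count_space UNIV)"
        unfolding mark_sum_def using elim by simp
      also have "ennreal (norm \<dots>) \<le> (\<integral>\<^sup>+k. norm (a (Z k \<omega>) *\<^sub>R V k \<omega> - a' (Z k \<omega>) *\<^sub>R V k \<omega>) \<partial>count_space UNIV)"
        using elim by (intro integral_norm_bound_ennreal Bochner_Integration.integrable_diff)
      also have "\<dots> = (\<integral>\<^sup>+k. ennreal \<bar>a (Z k \<omega>) - a' (Z k \<omega>)\<bar> \<partial>count_space UNIV)"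
        using elim by (simp add: scaleR_left_diff_distrib[symmetric])
      finally show ?case .
    qed
  qed
  also have "\<dots> \<le> ennreal (l * d)" using nn_integral_dominated[OF assms(3)] .
  finally have *: "(\<integral>\<^sup>+\<omega>. norm (mark_sum a \<omega> - mark_sum a' \<omega>) \<partial>M) \<le> ennreal (l * d)" .
  show "integrable M (\<lambda>\<omega>. norm (mark_sum a \<omega> - mark_sum a' \<omega>))"
    using le_less_trans[OF *, of \<infinity>] by (intro integrableI_bounded) auto
  show "expectation (\<lambda>\<omega>. norm (mark_sum a \<omega> - mark_sum a' \<omega>)) \<le> l * d"
    using * d l_pos by (intro integral_real_bounded) auto
qed

lemma bounded_lipschitz_mark_sum_dist:
  assumes "dominated a b" "dominated a' b'" "dominated (\<lambda>t. a t - a' t) d"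
    and g: "bounded_lipschitz B L g"
  shows "\<bar>expectation (\<lambda>\<omega>. g (mark_sum a \<omega>)) - expectation (\<lambda>\<omega>. g (mark_sum a' \<omega>))\<bar> \<le> L * (l * d)"
proof -
  have [measurable]: "a \<in> borel_measurable borel" "a' \<in> borel_measurable borel"
    using assms by (auto simp: dominated_def)
  have i: "integrable M (\<lambda>\<omega>. g (mark_sum a \<omega>))" "integrable M (\<lambda>\<omega>. g (mark_sum a' \<omega>))"
    by (simp_all add: integrable_bounded_lipschitz[OF g])
  have "\<bar>expectation (\<lambda>\<omega>. g (mark_sum a \<omega>) - g (mark_sum a' \<omega>))\<bar>
      \<le> expectation (\<lambda>\<omega>. \<bar>g (mark_sum a \<omega>) - g (mark_sum a' \<omega>)\<bar>)"
    by (rule integral_abs_bound)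
  also have "\<dots> \<le> expectation (\<lambda>\<omega>. L * norm (mark_sum a \<omega> - mark_sum a' \<omega>))"
  proof (rule integral_mono)
    show "integrable M (\<lambda>\<omega>. L * norm (mark_sum a \<omega> - mark_sum a' \<omega>))"
      using mark_sum_dist(1)[OF assms(1-3)] by simp
  qed (use i in simp, rule bounded_lipschitzD(2)[OF g])
  also have "\<dots> \<le> L * (l * d)"
    using mark_sum_dist(2)[OF assms(1-3)] bounded_lipschitzD(3)[OF g] by (simp add: mult_left_mono)
  finally show ?thesis using i by simp
qed

text \<open>Points of the first \<open>m\<close> cells are moved to the upper end of their cell and the others are dropped.\<close>

definition grid_round :: "nat \<Rightarrow> real \<Rightarrow> real" where
  "grid_round m t = (\<Sum>j<m. q ^ j * indicator (cell j) t)"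

lemma grid_round_cell:
  assumes t: "t \<in> cell j"
  shows "grid_round m t = (if j < m then q ^ j else 0)"
proof -
  have "q ^ i * indicator (cell i) t = (if i = j then q ^ j else 0)" for i
  proof (cases "i = j")
    case False
    then have "t \<notin> cell i" using t cell_unique by blast
    then show ?thesis using False by simp
  qed (simp add: t)
  then show ?thesis by (simp add: grid_round_def)
qed

lemma grid_round_0: "(\<And>j. t \<notin> cell j) \<Longrightarrow> grid_round m t = 0"
  by (simp add: grid_round_def)

lemma measurable_grid_round [measurable]: "grid_round m \<in> borel_measurable borel"
  unfolding grid_round_def[abs_def] by measurable

lemma dominatedI:
  assumes "a \<in> borel_measurable borel" "\<And>j. 0 \<le> \<beta> j" "\<beta> sums b"
    and "\<And>t j. t \<in> cell j \<Longrightarrow> \<bar>a t\<bar> \<le> \<beta> j" "\<And>t. 1 < t \<Longrightarrow> a t = 0"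
  shows "dominated a b"
  unfolding dominated_def
proof (intro conjI exI[of _ \<beta>] allI impI)
  fix t :: real assume t: "0 < t"
  show "ennreal \<bar>a t\<bar> \<le> grid_step \<beta> t"
  proof (cases "t \<le> 1")
    case True
    then obtain j where "t \<in> cell j" using t cell_exists by blast
    then show ?thesis
      by (intro order_trans[OF ennreal_leI[OF assms(4)] grid_step_ge])
  qed (use assms(5) in simp)
qed fact+

lemma geometric_q: "(\<lambda>j. q ^ j) sums (1 / (1 - q))"
  using q_bounds by (intro geometric_sums) simp

lemma not_in_cell: "1 < t \<Longrightarrow> t \<notin> cell j"
  using cell_bounds[of t j] by auto

lemma dominated_trunc: "dominated trunc (1 / (1 - q))"
proof (rule dominatedI[OF measurable_trunc _ geometric_q])
  show "\<bar>trunc t\<bar> \<le> q ^ j" if "t \<in> cell j" for t j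
    using that cell_bounds[OF that] by (simp add: trunc_def cell_def)
qed (use q_bounds in \<open>simp_all add: trunc_def\<close>)

lemma dominated_grid_round: "dominated (grid_round m) (1 / (1 - q))"
proof (rule dominatedI[OF measurable_grid_round _ geometric_q])
  show "\<bar>grid_round m t\<bar> \<le> q ^ j" if "t \<in> cell j" for t j
    using q_bounds by (simp add: grid_round_cell[OF that])
qed (use q_bounds in \<open>simp_all add: grid_round_0 not_in_cell\<close>)

lemma dominated_grid_round_Suc: "dominated (\<lambda>t. grid_round (Suc m) t - grid_round m t) (q ^ m)"
proof (rule dominatedI)
  show "(\<lambda>j. if j = m then q ^ j else 0) sums q ^ m" by (rule sums_single)
  show "\<bar>grid_round (Suc m) t - grid_round m t\<bar> \<le> (if j = m then q ^ j else 0)" if "t \<in> cell j" for t j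
    using q_bounds by (simp add: grid_round_cell[OF that])
qed (use q_bounds in \<open>simp_all add: grid_round_0 not_in_cell\<close>)

text \<open>The crucial estimate of the discretisation: after multiplication by \<open>l\<close>, rounding costs at most
  \<open>l\<close> in expectation. The first summand comes from the width \<open>(1 - q) * q ^ j\<close> of the cells and the
  second one from the dropped points below \<open>q ^ m\<close>.\<close>

lemma dominated_trunc_diff: "dominated (\<lambda>t. grid_round m t - trunc t) (1 + q ^ m / (1 - q))"
proof (rule dominatedI[where \<beta>="\<lambda>j. (1 - q) * q ^ j + (if j < m then 0 else q ^ j)"])
  have "(\<lambda>j. q ^ m * q ^ j) sums (q ^ m * (1 / (1 - q)))" by (intro sums_mult geometric_q)
  then have "(\<lambda>j. if j < m then 0 else q ^ j) sums (q ^ m / (1 - q))"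
    using sums_iff_shift[of "\<lambda>j. if j < m then 0 else q ^ j" m "q ^ m / (1 - q)"]
    by (simp add: power_add mult.commute)
  moreover have "(\<lambda>j. (1 - q) * q ^ j) sums ((1 - q) * (1 / (1 - q)))" by (intro sums_mult geometric_q)
  ultimately show "(\<lambda>j. (1 - q) * q ^ j + (if j < m then 0 else q ^ j)) sums (1 + q ^ m / (1 - q))"
    using q_bounds by (intro sums_add) auto
  show "0 \<le> (1 - q) * q ^ j + (if j < m then 0 else q ^ j)" for j using q_bounds by auto
  show "\<bar>grid_round m t - trunc t\<bar> \<le> (1 - q) * q ^ j + (if j < m then 0 else q ^ j)" if t: "t \<in> cell j" for t j
  proof -
    have "q ^ j - q * q ^ j < q ^ j" using q_bounds by simp
    then show ?thesis
      using t cell_bounds[OF t] by (simp add: grid_round_cell[OF t] trunc_def cell_def left_diff_distrib)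
  qed
  show "grid_round m t - trunc t = 0" if "1 < t" for t
    using that by (simp add: grid_round_0 not_in_cell trunc_def)
qed simp

section \<open>The discretised vector\<close>

text \<open>Here \<open>z\<close> is a deterministic configuration and only the marks are random.\<close>

lemma grid_sum_layered:
  assumes z: "\<And>j. finite {k. z k \<in> cell j}" and g: "bounded_lipschitz B L g"
  shows "expectation (\<lambda>\<omega>. g (\<integral>k. grid_round m (z k) *\<^sub>R V k \<omega> \<partial>count_space UNIV))
    = layered q \<nu> g (\<lambda>j. card {k. z k \<in> cell j}) m"
proof -
  define K where "K = (\<Union>j<m. {k. z k \<in> cell j})"
  define J where "J k = (THE j. z k \<in> cell j)" for k
  have J: "J k = j" if "z k \<in> cell j" for k j
    unfolding J_def using that cell_unique by blast
  have K: "finite K" unfolding K_def using z by blast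
  have JK: "J ` K \<subseteq> {..<m}" by (auto simp: K_def J)
  have out: "grid_round m (z k) = 0" if "k \<notin> K" for k
  proof (cases "\<exists>j. z k \<in> cell j")
    case True
    then obtain j where "z k \<in> cell j" by blast
    then show ?thesis using that by (auto simp: grid_round_cell K_def)
  qed (simp add: grid_round_0)
  have on: "grid_round m (z k) = q ^ J k" if kK: "k \<in> K" for k
  proof -
    obtain j where "j < m" "z k \<in> cell j" using kK by (auto simp: K_def)
    then show ?thesis by (simp add: grid_round_cell J)
  qed
  have "(\<integral>k. grid_round m (z k) *\<^sub>R V k \<omega> \<partial>count_space UNIV) = (\<Sum>k\<in>K. q ^ J k *\<^sub>R V k \<omega>)" for \<omega>
  proof -
    have sub: "{k. grid_round m (z k) *\<^sub>R V k \<omega> \<noteq> 0} \<subseteq> K" using out by auto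
    have "(\<integral>k. grid_round m (z k) *\<^sub>R V k \<omega> \<partial>count_space UNIV)
        = (\<Sum>k | k \<in> UNIV \<and> grid_round m (z k) *\<^sub>R V k \<omega> \<noteq> 0. grid_round m (z k) *\<^sub>R V k \<omega>)"
      by (rule lebesgue_integral_count_space_finite_support)
         (use finite_subset[OF sub K] in simp)
    also have "\<dots> = (\<Sum>k\<in>K. grid_round m (z k) *\<^sub>R V k \<omega>)"
      by (rule sum.mono_neutral_left) (use K sub in auto)
    also have "\<dots> = (\<Sum>k\<in>K. q ^ J k *\<^sub>R V k \<omega>)"
      by (rule sum.cong) (simp_all add: on)
    finally show ?thesis .
  qed
  then have "expectation (\<lambda>\<omega>. g (\<integral>k. grid_round m (z k) *\<^sub>R V k \<omega> \<partial>count_space UNIV))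
      = expectation (\<lambda>\<omega>. g (\<Sum>k\<in>K. q ^ J k *\<^sub>R V k \<omega>))" by simp
  also have "\<dots> = layered q \<nu> g (\<lambda>j. card {k\<in>K. J k = j}) m"
    using q_bounds by (intro expectation_eq_layered[OF V_indep V_law K JK _ _ g]) auto
  also have "\<dots> = layered q \<nu> g (\<lambda>j. card {k. z k \<in> cell j}) m"
  proof (rule layered_cong)
    fix j assume "j < m"
    then have "{k\<in>K. J k = j} = {k. z k \<in> cell j}" by (auto simp: K_def J)
    then show "card {k\<in>K. J k = j} = card {k. z k \<in> cell j}" by simp
  qed
  finally show ?thesis .
qed

text \<open>Marks and points are independent, so that the points may be frozen while the marks are integrated
  out.\<close>

lemma expectation_grid_sum:
  assumes g: "bounded_lipschitz B L g"
  shows "expectation (\<lambda>\<omega>. g (mark_sum (grid_round m) \<omega>)) = expectation (\<lambda>\<omega>. layered q \<nu> g (\<lambda>j. N j \<omega>) m)"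
proof -
  let ?A = "\<Pi>\<^sub>M k\<in>(UNIV :: nat set). (borel :: 'a measure)" and ?R = "\<Pi>\<^sub>M k\<in>(UNIV :: nat set). (borel :: real measure)"
  let ?V = "\<lambda>\<omega> k. V k \<omega>" and ?Z = "\<lambda>\<omega> k. Z k \<omega>"
  define h where "h v z = g (\<integral>k. grid_round m (z k) *\<^sub>R v k \<partial>count_space UNIV)" for v :: "nat \<Rightarrow> 'a" and z :: "nat \<Rightarrow> real"
  have [measurable]: "g \<in> borel_measurable borel" by (rule bounded_lipschitz_measurable[OF g])
  have Vm[measurable]: "?V \<in> M \<rightarrow>\<^sub>M ?A" and Zm[measurable]: "?Z \<in> M \<rightarrow>\<^sub>M ?R"
    using VZ_indep by (simp_all add: indep_rv_def)
  have h[measurable]: "(\<lambda>(v, z). h v z) \<in> borel_measurable (?A \<Otimes>\<^sub>M ?R)"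
  proof -
    have "(\<lambda>x. \<integral>k. grid_round m (snd x k) *\<^sub>R fst x k \<partial>count_space UNIV) \<in> borel_measurable (?A \<Otimes>\<^sub>M ?R)"
      by (rule borel_measurable_integral_count_space) measurable
    then show ?thesis unfolding h_def case_prod_unfold by measurable
  qed
  interpret LV: prob_space "distr M ?A ?V" by (rule prob_space_distr) simp
  interpret LZ: prob_space "distr M ?R ?Z" by (rule prob_space_distr) simp
  interpret LVZ: pair_prob_space "distr M ?A ?V" "distr M ?R ?Z" ..
  have hB: "\<bar>h v z\<bar> \<le> B" for v z using bounded_lipschitzD(1)[OF g] by (simp add: h_def)
  have "expectation (\<lambda>\<omega>. g (mark_sum (grid_round m) \<omega>))
      = (\<integral>(v, z). h v z \<partial>distr M (?A \<Otimes>\<^sub>M ?R) (\<lambda>\<omega>. (?V \<omega>, ?Z \<omega>)))"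
    by (subst integral_distr) (simp_all add: h_def mark_sum_def)
  also have "\<dots> = (\<integral>(v, z). h v z \<partial>(distr M ?A ?V \<Otimes>\<^sub>M distr M ?R ?Z))"
    by (simp add: distr_Pair_indep_rv[OF prob_space_axioms VZ_indep])
  also have "\<dots> = (\<integral>z. (\<integral>v. h v z \<partial>distr M ?A ?V) \<partial>distr M ?R ?Z)"
    by (rule LVZ.integral_snd[symmetric], rule LVZ.P.integrable_const_bound[of _ B])
       (use hB in auto)
  also have "\<dots> = expectation (\<lambda>\<omega>'. \<integral>v. h v (?Z \<omega>') \<partial>distr M ?A ?V)"
    by (subst integral_distr) simp_all
  also have "\<dots> = expectation (\<lambda>\<omega>'. expectation (\<lambda>\<omega>. h (?V \<omega>) (?Z \<omega>')))"
  proof (rule Bochner_Integration.integral_cong[OF refl])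
    fix \<omega>' assume "\<omega>' \<in> space M"
    then have "?Z \<omega>' \<in> space ?R" using measurable_space[OF Zm] by blast
    then have "(\<lambda>v. h v (?Z \<omega>')) \<in> borel_measurable ?A" by measurable
    then show "(\<integral>v. h v (?Z \<omega>') \<partial>distr M ?A ?V) = expectation (\<lambda>\<omega>. h (?V \<omega>) (?Z \<omega>'))"
      by (intro integral_distr) simp_all
  qed
  also have "\<dots> = expectation (\<lambda>\<omega>. layered q \<nu> g (\<lambda>j. N j \<omega>) m)"
  proof (rule integral_cong_AE)
    have rv[measurable]: "random_variable (count_space UNIV) (N j)" for j
      using N_indep by (simp add: indep_vars_def)
    show "(\<lambda>\<omega>. layered q \<nu> g (\<lambda>j. N j \<omega>) m) \<in> borel_measurable M"
      by (rule measurable_layered) simp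
    show "(\<lambda>\<omega>'. expectation (\<lambda>\<omega>. h (?V \<omega>) (?Z \<omega>'))) \<in> borel_measurable M"
      by measurable
    have "AE \<omega> in M. \<forall>j. ecount j \<omega> = of_nat (N j \<omega>)"
      unfolding AE_all_countable using AE_ecount_finite by blast
    then show "AE \<omega>' in M. expectation (\<lambda>\<omega>. h (?V \<omega>) (?Z \<omega>')) = layered q \<nu> g (\<lambda>j. N j \<omega>') m"
    proof eventually_elim
      case (elim \<omega>')
      have "finite {k. Z k \<omega>' \<in> cell j}" for j
      proof (rule ccontr)
        assume "infinite {k. Z k \<omega>' \<in> cell j}"
        then have "ecount j \<omega>' = \<infinity>" by (simp add: ecount_def)
        then show False using elim by (metis ennreal_of_nat_neq_top infinity_ennreal_def)
      qed
      from grid_sum_layered[OF this g] show ?case by (simp add: h_def N_def)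
    qed
  qed
  finally show ?thesis .
qed

lemma grid_sum_first_order:
  assumes g: "bounded_lipschitz B L g"
  shows "\<bar>expectation (\<lambda>\<omega>. g (mark_sum (grid_round (Suc m)) \<omega>))
      - exp (- l) * expectation (\<lambda>\<omega>. g (q *\<^sub>R mark_sum (grid_round m) \<omega>))
      - l * exp (- l) * expectation (\<lambda>\<omega>. shift_mean \<nu> g (q *\<^sub>R mark_sum (grid_round m) \<omega>))\<bar>
    \<le> (1 - exp (- l) - l * exp (- l)) * B"
proof -
  have q: "0 \<le> q" "q \<le> 1" using q_bounds by auto
  note b0 = bounded_lipschitz_scale[OF g, of q]
  note b1 = bounded_lipschitz_scale[OF bounded_lipschitz_shift_mean[OF prob_space_\<nu> sets_\<nu> g], of q]
  have "measure (measure_pmf (poisson_pmf l)) {0} = exp (- l)"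
    "measure (measure_pmf (poisson_pmf l)) {1} = l * exp (- l)"
    using l_pos by (simp_all add: measure_pmf_single)
  then show ?thesis
    using expectation_layered_first_order[OF N_indep N_law prob_space_\<nu> sets_\<nu> g q, of m]
    by (simp only: expectation_grid_sum[OF g] expectation_grid_sum[OF b0] expectation_grid_sum[OF b1])
qed

lemma dominated_0: "dominated (\<lambda>_. 0) 0"
  by (rule dominatedI[of _ "\<lambda>_. 0"]) auto

lemma grid_sum_norm:
  shows "integrable M (\<lambda>\<omega>. norm (mark_sum (grid_round m) \<omega>))"
    and "expectation (\<lambda>\<omega>. norm (mark_sum (grid_round m) \<omega>)) \<le> l / (1 - q)"
proof -
  have "dominated (\<lambda>t. grid_round m t - 0) (1 / (1 - q))" using dominated_grid_round[of m] by simp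
  from mark_sum_dist[OF dominated_grid_round dominated_0 this]
  show "integrable M (\<lambda>\<omega>. norm (mark_sum (grid_round m) \<omega>))"
    "expectation (\<lambda>\<omega>. norm (mark_sum (grid_round m) \<omega>)) \<le> l / (1 - q)"
    by (simp_all add: mark_sum_def)
qed

text \<open>For \<open>f = shrink_mean c g\<close>, let \<open>Y\<close> be the discretised vector. By self-similarity, \<open>E (f Y)\<close> is
  \<open>p0 * E (f (q Y)) + p1 * E (shift_mean \<nu> f (q Y))\<close> up to an error of order \<open>l\<^sup>2\<close>. On the other hand, the choice
  of \<open>q\<close> gives \<open>p0 powr (1 / c) = q\<close>, and then \<open>f Y - p0 * f (q Y)\<close> is \<open>(1 - p0) * g Y\<close> up to the same
  order. Comparing both, the terms with \<open>f (q Y)\<close> cancel, leaving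
  \<open>(1 - p0) * E (g Y) = p1 * E (shift_mean \<nu> f (q Y))\<close> up to order \<open>l\<^sup>2\<close>, where \<open>1 - p0\<close> and \<open>p1\<close> are both
  equal to \<open>l\<close> to first order. Replacing \<open>Y\<close> and \<open>q Y\<close> by the exact vector costs a further error of
  order \<open>l\<close> under these factors, so that division by \<open>l\<close> leaves the asserted bound.\<close>

lemma near_invariance:
  assumes g: "bounded_lipschitz B L g"
  shows "\<bar>expectation (\<lambda>\<omega>. g (mark_sum trunc \<omega>))
      - expectation (\<lambda>\<omega>. shift_mean \<nu> (shrink_mean c g) (mark_sum trunc \<omega>))\<bar> \<le> l * (3 * B + 4 * L)"
proof -
  define f where "f = shrink_mean c g"
  define F where "F = shift_mean \<nu> f"
  define p0 where "p0 = exp (- l)"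
  define p1 where "p1 = l * exp (- l)"
  note D = bounded_lipschitzD[OF g]
  have f: "bounded_lipschitz B L f"
    unfolding f_def
    by (rule bounded_lipschitz_mono[OF bounded_lipschitz_shrink_mean[OF g c_pos]])
       (use D(3) c_pos in \<open>intro mult_left_le, auto\<close>)
  have F: "bounded_lipschitz B L F"
    unfolding F_def by (rule bounded_lipschitz_shift_mean[OF prob_space_\<nu> sets_\<nu> f])
  have qp: "p0 powr (1 / c) = q" by (simp add: p0_def q_def powr_def)
  have p0: "0 < p0" "p0 \<le> 1" "0 \<le> p1" using l_pos by (simp_all add: p0_def p1_def)
  define Y where "Y m = mark_sum (grid_round m)" for m
  have Ym[measurable]: "Y m \<in> borel_measurable M" for m unfolding Y_def by simp
  define Eg where "Eg = expectation (\<lambda>\<omega>. g (mark_sum trunc \<omega>))"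
  define EF where "EF = expectation (\<lambda>\<omega>. F (mark_sum trunc \<omega>))"
  \<comment> \<open>The number \<open>m\<close> of cells is sent to infinity with the grid fixed; only then does \<open>l\<close> vary.\<close>
  have bound: "\<bar>(1 - p0) * Eg - p1 * EF\<bar> \<le> 4 * L * l\<^sup>2 + B * l\<^sup>2 + q ^ m * (L * l + 2 * (l * (L * (l / (1 - q)))))" for m
  proof -
    define e where "e = q ^ m / (1 - q)"
    have e: "0 \<le> e" using q_bounds by (simp add: e_def)
    have Yn: "integrable M (\<lambda>\<omega>. norm (Y m \<omega>))" "expectation (\<lambda>\<omega>. norm (Y m \<omega>)) \<le> l / (1 - q)"
      unfolding Y_def by (rule grid_sum_norm)+
    have qY: "(1 - q) * expectation (\<lambda>\<omega>. norm (Y m \<omega>)) \<le> l"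
      using mult_left_mono[OF Yn(2), of "1 - q"] q_bounds by simp
    have ig: "integrable M (\<lambda>\<omega>. g (Y m \<omega>))" and if0: "integrable M (\<lambda>\<omega>. f (Y m \<omega>))"
      and ifq: "integrable M (\<lambda>\<omega>. f (q *\<^sub>R Y m \<omega>))" and iF: "integrable M (\<lambda>\<omega>. F (Y m \<omega>))"
      and iFq: "integrable M (\<lambda>\<omega>. F (q *\<^sub>R Y m \<omega>))"
      by (simp_all add: integrable_bounded_lipschitz[OF g] integrable_bounded_lipschitz[OF f]
        integrable_bounded_lipschitz[OF F])
    have a: "\<bar>expectation (\<lambda>\<omega>. f (Y m \<omega>)) - p0 * expectation (\<lambda>\<omega>. f (q *\<^sub>R Y m \<omega>))
        - (1 - p0) * expectation (\<lambda>\<omega>. g (Y m \<omega>))\<bar> \<le> (1 - p0) * (L * l)"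
    proof -
      have "\<bar>expectation (\<lambda>\<omega>. f (Y m \<omega>) - p0 * f (q *\<^sub>R Y m \<omega>) - (1 - p0) * g (Y m \<omega>))\<bar>
        \<le> expectation (\<lambda>\<omega>. \<bar>f (Y m \<omega>) - p0 * f (q *\<^sub>R Y m \<omega>) - (1 - p0) * g (Y m \<omega>)\<bar>)"
        by (rule integral_abs_bound)
      also have "\<dots> \<le> expectation (\<lambda>\<omega>. (1 - p0) * (L * ((1 - q) * norm (Y m \<omega>))))"
      proof (rule integral_mono)
        show "\<bar>f (Y m \<omega>) - p0 * f (q *\<^sub>R Y m \<omega>) - (1 - p0) * g (Y m \<omega>)\<bar>
          \<le> (1 - p0) * (L * ((1 - q) * norm (Y m \<omega>)))" for \<omega>
          using shrink_mean_split[OF g c_pos p0(1,2), of "Y m \<omega>"] by (simp add: f_def qp)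
      qed (use ig if0 ifq Yn in simp_all)
      also have "\<dots> = (1 - p0) * (L * ((1 - q) * expectation (\<lambda>\<omega>. norm (Y m \<omega>))))"
        by simp
      also have "\<dots> \<le> (1 - p0) * (L * l)"
        using qY D(3) p0 by (intro mult_left_mono) auto
      finally show ?thesis using ig if0 ifq by simp
    qed
    have b: "\<bar>expectation (\<lambda>\<omega>. f (Y (Suc m) \<omega>)) - p0 * expectation (\<lambda>\<omega>. f (q *\<^sub>R Y m \<omega>))
        - p1 * expectation (\<lambda>\<omega>. F (q *\<^sub>R Y m \<omega>))\<bar> \<le> (1 - p0 - p1) * B"
      using grid_sum_first_order[OF f, of m] by (simp add: p0_def p1_def Y_def F_def)
    have c: "\<bar>expectation (\<lambda>\<omega>. f (Y (Suc m) \<omega>)) - expectation (\<lambda>\<omega>. f (Y m \<omega>))\<bar> \<le> L * (l * q ^ m)"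
      unfolding Y_def
      by (rule bounded_lipschitz_mark_sum_dist[OF dominated_grid_round dominated_grid_round dominated_grid_round_Suc f])
    have d: "\<bar>expectation (\<lambda>\<omega>. g (Y m \<omega>)) - Eg\<bar> \<le> L * (l * (1 + e))"
      unfolding Y_def Eg_def e_def
      by (rule bounded_lipschitz_mark_sum_dist[OF dominated_grid_round dominated_trunc dominated_trunc_diff g])
    have d': "\<bar>expectation (\<lambda>\<omega>. F (Y m \<omega>)) - EF\<bar> \<le> L * (l * (1 + e))"
      unfolding Y_def EF_def e_def
      by (rule bounded_lipschitz_mark_sum_dist[OF dominated_grid_round dominated_trunc dominated_trunc_diff F])
    have e1: "\<bar>expectation (\<lambda>\<omega>. F (q *\<^sub>R Y m \<omega>)) - expectation (\<lambda>\<omega>. F (Y m \<omega>))\<bar> \<le> L * l"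
    proof -
      have "\<bar>expectation (\<lambda>\<omega>. F (q *\<^sub>R Y m \<omega>) - F (Y m \<omega>))\<bar>
          \<le> expectation (\<lambda>\<omega>. \<bar>F (q *\<^sub>R Y m \<omega>) - F (Y m \<omega>)\<bar>)"
        by (rule integral_abs_bound)
      also have "\<dots> \<le> expectation (\<lambda>\<omega>. L * ((1 - q) * norm (Y m \<omega>)))"
      proof (rule integral_mono)
        show "\<bar>F (q *\<^sub>R Y m \<omega>) - F (Y m \<omega>)\<bar> \<le> L * ((1 - q) * norm (Y m \<omega>))" for \<omega>
        proof -
          define w where "w = Y m \<omega>"
          have "q *\<^sub>R w - w = (q - 1) *\<^sub>R w" by (simp add: scaleR_left_diff_distrib)
          then have "norm (q *\<^sub>R w - w) = (1 - q) * norm w" using q_bounds by simp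
          then show ?thesis using bounded_lipschitzD(2)[OF F, of "q *\<^sub>R w" w] by (simp add: w_def)
        qed
      qed (use iF iFq Yn in simp_all)
      also have "\<dots> = L * ((1 - q) * expectation (\<lambda>\<omega>. norm (Y m \<omega>)))" by simp
      also have "\<dots> \<le> L * l" using qY D(3) by (intro mult_left_mono)
      finally show ?thesis using iF iFq by simp
    qed
    have d2: "\<bar>(1 - p0) * expectation (\<lambda>\<omega>. g (Y m \<omega>)) - (1 - p0) * Eg\<bar> \<le> (1 - p0) * (L * (l * (1 + e)))"
      using mult_left_mono[OF d, of "1 - p0"] p0 by (simp add: right_diff_distrib[symmetric] abs_mult)
    have e2: "\<bar>p1 * expectation (\<lambda>\<omega>. F (q *\<^sub>R Y m \<omega>)) - p1 * EF\<bar> \<le> p1 * (L * l + L * (l * (1 + e)))"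
    proof -
      have "\<bar>expectation (\<lambda>\<omega>. F (q *\<^sub>R Y m \<omega>)) - EF\<bar> \<le> L * l + L * (l * (1 + e))" using e1 d' by linarith
      from mult_left_mono[OF this p0(3)] show ?thesis
        using p0 by (simp add: right_diff_distrib[symmetric] abs_mult)
    qed
    have "\<bar>(1 - p0) * Eg - p1 * EF\<bar> \<le> (1 - p0) * (L * l) + (1 - p0 - p1) * B + L * (l * q ^ m)
        + (1 - p0) * (L * (l * (1 + e))) + p1 * (L * l + L * (l * (1 + e)))"
      using a b c d2 e2 by linarith
    also have "\<dots> \<le> l * (L * l) + l\<^sup>2 * B + L * (l * q ^ m)
        + l * (L * (l * (1 + e))) + l * (L * l + L * (l * (1 + e)))"
    proof -
      have ex: "1 - l \<le> p0" using exp_ge_add_one_self[of "- l"] by (simp add: p0_def)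
      have "p1 = l * p0" by (simp add: p1_def p0_def)
      then have "l * (1 - l) \<le> p1" "p1 \<le> l" using ex p0 l_pos by (auto intro: mult_left_mono simp: mult_left_le)
      moreover have "1 - p0 - p1 \<le> l\<^sup>2" using calculation ex by (simp add: power2_eq_square algebra_simps)
      moreover have "0 \<le> L * l" "0 \<le> L * (l * (1 + e))" using D(3) l_pos e by auto
      ultimately show ?thesis
        using ex D(4) by (intro add_mono mult_right_mono order_refl) auto
    qed
    also have "\<dots> = 4 * L * l\<^sup>2 + B * l\<^sup>2 + (L * l * q ^ m + 2 * (l * (L * (l * e))))"
      by (simp add: algebra_simps power2_eq_square)
    also have "L * l * q ^ m + 2 * (l * (L * (l * e))) = q ^ m * (L * l + 2 * (l * (L * (l / (1 - q)))))"
      by (simp add: e_def algebra_simps)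
    finally show ?thesis .
  qed
  have "(\<lambda>m. 4 * L * l\<^sup>2 + B * l\<^sup>2 + q ^ m * (L * l + 2 * (l * (L * (l / (1 - q))))))
      \<longlonglongrightarrow> 4 * L * l\<^sup>2 + B * l\<^sup>2 + 0 * (L * l + 2 * (l * (L * (l / (1 - q)))))"
    using q_bounds by (intro tendsto_intros) auto
  then have lim: "\<bar>(1 - p0) * Eg - p1 * EF\<bar> \<le> 4 * L * l\<^sup>2 + B * l\<^sup>2"
    using LIMSEQ_le_const[of _ "4 * L * l\<^sup>2 + B * l\<^sup>2 + 0 * (L * l + 2 * (l * (L * (l / (1 - q)))))"] bound
    by fastforce
  have p0_le: "1 - l \<le> p0" using exp_ge_add_one_self[of "- l"] by (simp add: p0_def)
  have "1 - p0 \<ge> l - l\<^sup>2"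
  proof -
    have "p0 * (1 + l) \<le> 1"
      using mult_left_mono[OF exp_ge_add_one_self[of l], of p0] p0 by (simp add: p0_def exp_minus)
    moreover have "(1 - l + l\<^sup>2) * (1 + l) = 1 + l ^ 3" by (simp add: algebra_simps power2_eq_square power3_eq_cube)
    moreover have "0 \<le> l ^ 3" using l_pos by simp
    ultimately have "p0 * (1 + l) \<le> (1 - l + l\<^sup>2) * (1 + l)" by linarith
    then show ?thesis using l_pos by simp
  qed
  then have A: "\<bar>(l - (1 - p0)) * Eg\<bar> \<le> l\<^sup>2 * B"
    unfolding abs_mult using p0_le D(1) D(4)
    by (intro mult_mono) (auto simp: Eg_def intro!: abs_expectation_le)
  have "p1 \<le> l" "l - l\<^sup>2 \<le> p1"
    using p0 l_pos mult_left_mono[OF p0_le, of l] mult_left_mono[OF p0(2), of l]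
    by (simp_all add: p1_def p0_def power2_eq_square algebra_simps)
  then have A': "\<bar>(l - p1) * EF\<bar> \<le> l\<^sup>2 * B"
    unfolding abs_mult using D(4) bounded_lipschitzD(1)[OF F]
    by (intro mult_mono) (auto simp: EF_def intro!: abs_expectation_le)
  have "l * \<bar>Eg - EF\<bar> = \<bar>l * (Eg - EF)\<bar>" using l_pos by (simp add: abs_mult)
  also have "\<dots> = \<bar>((1 - p0) * Eg - p1 * EF) + (l - (1 - p0)) * Eg - (l - p1) * EF\<bar>"
    by (simp add: algebra_simps)
  also have "\<dots> \<le> (4 * L * l\<^sup>2 + B * l\<^sup>2) + l\<^sup>2 * B + l\<^sup>2 * B" using lim A A' by linarith
  also have "\<dots> = l * (l * (3 * B + 4 * L))" by (simp add: power2_eq_square algebra_simps)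
  finally show ?thesis using l_pos by (simp add: Eg_def EF_def F_def f_def)
qed

end

section \<open>The fixed point\<close>

context dickman begin

lemma expectation_invariance:
  assumes g: "bounded_lipschitz B L g"
  shows "expectation (\<lambda>\<omega>. g (mark_sum trunc \<omega>))
      = expectation (\<lambda>\<omega>. shift_mean \<nu> (shrink_mean c g) (mark_sum trunc \<omega>))" (is "?a = ?b")
proof (rule ccontr)
  assume ne: "?a \<noteq> ?b"
  let ?C = "3 * B + 4 * L"
  have C: "0 \<le> ?C" using bounded_lipschitzD(3,4)[OF g] by simp
  \<comment> \<open>Two values that differ violate the bound for cells of this mass.\<close>
  define l where "l = \<bar>?a - ?b\<bar> / (?C + 1)"
  have l: "0 < l" using ne C by (simp add: l_def)
  interpret dickman_grid M c \<nu> Z V l by unfold_locales (rule l)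
  have "\<bar>?a - ?b\<bar> \<le> l * ?C" by (rule near_invariance[OF g])
  also have "\<dots> < l * (?C + 1)" using l by simp
  also have "\<dots> = \<bar>?a - ?b\<bar>" using C by (simp add: l_def)
  finally show False by simp
qed

lemma dickman_transform_dickman_vector:
  "dickman_transform c \<nu> (distr M borel (dickman_vector Z V)) = distr M borel (dickman_vector Z V)"
proof -
  let ?\<mu> = "distr M borel (dickman_vector Z V)"
  have \<mu>: "?\<mu> = distr M borel (mark_sum trunc)"
    by (rule distr_cong_AE) (use dickman_vector_AE in auto)
  have P: "prob_space ?\<mu>" by (rule prob_space_distr) simp
  show ?thesis
  proof (rule measure_eq_bounded_lipschitz)
    show "prob_space (dickman_transform c \<nu> ?\<mu>)"
      by (rule prob_space_dickman_transform[OF prob_space_\<nu> P sets_\<nu>]) simp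
    show "sets (dickman_transform c \<nu> ?\<mu>) = sets borel" by (simp add: dickman_transform_def)
    fix B L and g :: "'a \<Rightarrow> real" assume g: "bounded_lipschitz B L g"
    have [measurable]: "g \<in> borel_measurable borel" by (rule bounded_lipschitz_measurable[OF g])
    have [measurable]: "shift_mean \<nu> (shrink_mean c g) \<in> borel_measurable borel"
      by (rule bounded_lipschitz_measurable[OF bounded_lipschitz_shift_mean[OF prob_space_\<nu> sets_\<nu>
            bounded_lipschitz_shrink_mean[OF g c_pos]]])
    have "(\<integral>x. g x \<partial>dickman_transform c \<nu> ?\<mu>) = (\<integral>w. shift_mean \<nu> (shrink_mean c g) w \<partial>?\<mu>)"
      by (rule integral_dickman_transform[OF prob_space_\<nu> P sets_\<nu> _ g c_pos]) simp
    also have "\<dots> = expectation (\<lambda>\<omega>. shift_mean \<nu> (shrink_mean c g) (mark_sum trunc \<omega>))"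
      unfolding \<mu> by (rule integral_distr) simp_all
    also have "\<dots> = (\<integral>x. g x \<partial>?\<mu>)"
      unfolding \<mu> expectation_invariance[OF g, symmetric] by (rule integral_distr[symmetric]) simp_all
    finally show "(\<integral>x. g x \<partial>dickman_transform c \<nu> ?\<mu>) = (\<integral>x. g x \<partial>?\<mu>)" .
  qed (use P in simp_all)
qed

end

theorem mainTheorem10:
  fixes c :: real
    and P :: "'p measure" and U :: "'p \<Rightarrow> real ^ 'd"
    and M :: "'w measure" and Z :: "nat \<Rightarrow> 'w \<Rightarrow> real" and V :: "nat \<Rightarrow> 'w \<Rightarrow> real ^ 'd"
  assumes "0 < c"
    and "prob_space P" and "U \<in> borel_measurable P" and "\<forall>\<omega>\<in>space P. norm (U \<omega>) = 1"
    and "dickman_data M c (distr P borel U) Z V"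
  shows "dickman_vector Z V \<in> borel_measurable M \<and>
    dickman_transform c (distr P borel U) (distr M borel (dickman_vector Z V)) =
      distr M borel (dickman_vector Z V) \<and>
    (\<forall>\<mu> :: (real ^ 'd) measure. prob_space \<mu> \<and> sets \<mu> = sets borel \<and>
       dickman_transform c (distr P borel U) \<mu> = \<mu> \<longrightarrow>
       \<mu> = distr M borel (dickman_vector Z V))"
proof -
  have "AE u in distr P borel U. norm u = 1"
    using assms(3,4) by (subst AE_distr_iff) auto
  then interpret dickman M c "distr P borel U" Z V
    using assms by unfold_locales auto
  have "prob_space (distr M borel (dickman_vector Z V))" by (rule prob_space_distr) simp
  then have "\<mu> = distr M borel (dickman_vector Z V)"
    if "prob_space \<mu>" "sets \<mu> = sets borel" "dickman_transform c (distr P borel U) \<mu> = \<mu>" for \<mu>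
    using dickman_transform_fixed_point_unique[OF prob_space_\<nu> sets_\<nu> c_pos that]
      dickman_transform_dickman_vector by simp
  then show ?thesis using dickman_transform_dickman_vector by simp
qed

end
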